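(* Let $d\ge 2$ and $q\ge 2$ be integers, and let $p\in[0,1]$ satisfy $p>p_c$, where $p_c$ is the critical probability of Bernoulli bond percolation on $\mathbb{Z}^d$. Let the disorder $J=(J_{\langle xy\rangle})_{\langle xy\rangle\in\mathcal{E}(\mathbb{Z}^d)}$ be distributed according to $P_p$, the product measure under which the $J_{\langle xy\rangle}$ are i.i.d. Bernoulli random variables with parameter $p$. Then there exists $\beta_0>0$ (depending on $d,q,p$) such that for every $\beta>\beta_0$ the $q$-state dilute clock model at inverse temperature $\beta$ exhibits phase co-existence for $P_p$-almost every $J$. More precisely, for every $\beta>\beta_0$, $$P_p\big(J:\ |\mathcal{G}_J|\ge q\big)=1,$$ where $\mathcal{G}_J$ is the set of Gibbs measures associated to the disorder $J$ (at inverse temperature $\beta$).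
   Context: Spin set: $S=\{2\pi i/q:\ i=0,\dots,q-1\}$ (angles). Spin configurations are elements $\sigma=(\sigma_x)_{x\in\mathbb{Z}^d}\in S^{\mathbb{Z}^d}$, with the $\sigma$-algebra generated by projections onto finite subsets of $\mathbb{Z}^d$. The edge set is $\mathcal{E}(\mathbb{Z}^d)=\{\langle xy\rangle:\ x,y\in\mathbb{Z}^d,\ \|x-y\|=1\}$ (unordered nearest-neighbour pairs, Euclidean norm). A disorder is an element $J\in\{0,1\}^{\mathcal{E}(\mathbb{Z}^d)}$. Hamiltonian: for finite $\Lambda\subset\mathbb{Z}^d$ and a disorder $J$, $$H_{\Lambda,J}(\sigma)=\sum_{\langle xy\rangle\in\mathcal{E}(\mathbb{Z}^d),\ \{x,y\}\cap\Lambda\ne\emptyset}J_{\langle xy\rangle}\big(1-\cos(\sigma_x-\sigma_y)\big).$$ Specification: for $\beta>0$, finite $\Lambda$, disorder $J$ and boundary condition $\eta\in S^{\mathbb{Z}^d}$, $\mu^\eta_{\Lambda,J}$ is the probability on $S^{\mathbb{Z}^d}$ given by $$\mu^\eta_{\Lambda,J}(\sigma)=\frac{1}{Z^\eta_{\Lambda,J}}\,e^{-\beta H_{\Lambda,J}(\sigma)}\,\mathbf{1}[\sigma_x=\eta_x\ \ \forall x\in\mathbb{Z}^d\setminus\Lambda],$$ with $Z^\eta_{\Lambda,J}$ the normalizing constant (it is supported on the finitely many $\sigma$ that agree with $\eta$ off $\Lambda$). Gibbs measures: a probability $\mu_J$ on $S^{\mathbb{Z}^d}$ is a Gibbs measure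 associated to $J$ if $\mu_J f=\int_{S^{\mathbb{Z}^d}}\mu_J(d\eta)\,\mu^\eta_{\Lambda,J}f$ for every finite $\Lambda\subset\mathbb{Z}^d$ and every local function $f:S^{\mathbb{Z}^d}\to\mathbb{R}$ (i.e. depending on finitely many coordinates), where $\mu f$ denotes the expectation of $f$ under $\mu$. $\mathcal{G}_J$ is the set of all such measures; phase co-existence means $|\mathcal{G}_J|>1$. Bernoulli bond percolation on $\mathbb{Z}^d$ with parameter $p$ keeps each edge open independently with probability $p$; $p_c$ is the supremum of those $p$ for which almost surely there is no infinite open cluster. *)

theory Defs
  imports "HOL-Probability.Probability" "HOL-Library.Equipollence"
begin

text \<open>
  The lattice \<open>\<int>\<^sup>d\<close> is the type \<open>int ^ 'd\<close> with \<open>d = CARD('d)\<close>.  The library has no norm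
  on it, so the Euclidean norm of \<open>x - y\<close> is taken after embedding into \<open>real ^ 'd\<close>.
  An unordered nearest-neighbour pair is the two-element set of its endpoints.
\<close>

definition lattice_edges :: "(int ^ 'd::finite) set set" where
  "lattice_edges = {{x, y} | x y. norm (\<chi> i. real_of_int (x $ i - y $ i)) = 1}"

text \<open>
  A disorder has \<open>J e = True\<close> for \<open>J\<^sub>e = 1\<close> and \<open>J e = False\<close> for \<open>J\<^sub>e = 0\<close>.
\<close>

definition disorder_law :: "real \<Rightarrow> ((int ^ 'd) set \<Rightarrow> bool) measure" where
  "disorder_law p = Pi\<^sub>M lattice_edges (\<lambda>_. measure_pmf (bernoulli_pmf p))"

definition open_cluster :: "((int ^ 'd) set \<Rightarrow> bool) \<Rightarrow> int ^ 'd \<Rightarrow> (int ^ 'd) set" where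
  "open_cluster J x = {(u, v). {u, v} \<in> lattice_edges \<and> J {u, v}}\<^sup>* `` {x}"

definition critical_prob :: "'d::finite itself \<Rightarrow> real" where
  "critical_prob _ = Sup {p \<in> {0..1}.
     AE J in disorder_law p. \<not> (\<exists>x :: int ^ 'd. infinite (open_cluster J x))}"

definition spin_set :: "nat \<Rightarrow> real set" where
  "spin_set q = (\<lambda>i. 2 * pi * real i / real q) ` {..<q}"

text \<open>
  Only the space \<open>S\<^bsup>\<int>\<^sup>d\<^esup>\<close> and its \<open>\<sigma>\<close>-algebra are meant here; the measure
  carried by this product of counting measures plays no role.
\<close>

definition config_space :: "nat \<Rightarrow> (int ^ 'd \<Rightarrow> real) measure" where
  "config_space q = Pi\<^sub>M UNIV (\<lambda>_. count_space (spin_set q))"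

text \<open>
  The bond energy \<open>1 - cos (\<sigma>\<^sub>x - \<sigma>\<^sub>y)\<close> as a function of the unordered pair \<open>{x, y}\<close>.
\<close>

definition bond_energy :: "('v \<Rightarrow> real) \<Rightarrow> 'v set \<Rightarrow> real" where
  "bond_energy \<sigma> e = (THE t. \<exists>x y. e = {x, y} \<and> t = 1 - cos (\<sigma> x - \<sigma> y))"

lemma bond_energy_pair: "bond_energy \<sigma> {x, y} = 1 - cos (\<sigma> x - \<sigma> y)"
proof -
  have "cos (\<sigma> y - \<sigma> x) = cos (\<sigma> x - \<sigma> y)"
    using cos_minus[of "\<sigma> x - \<sigma> y"] by simp
  then show ?thesis
    unfolding bond_energy_def by (intro the_equality) (auto simp: doubleton_eq_iff)
qed

definition hamiltonian ::
  "(int ^ 'd) set \<Rightarrow> ((int ^ 'd) set \<Rightarrow> bool) \<Rightarrow> (int ^ 'd \<Rightarrow> real) \<Rightarrow> real" where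
  "hamiltonian \<Lambda> J \<sigma> =
     (\<Sum>e \<in> {e \<in> lattice_edges. e \<inter> \<Lambda> \<noteq> {}}. of_bool (J e) * bond_energy \<sigma> e)"

definition agreeing_configs ::
  "nat \<Rightarrow> (int ^ 'd) set \<Rightarrow> (int ^ 'd \<Rightarrow> real) \<Rightarrow> (int ^ 'd \<Rightarrow> real) set" where
  "agreeing_configs q \<Lambda> \<eta> = {\<sigma> \<in> space (config_space q). \<forall>x. x \<notin> \<Lambda> \<longrightarrow> \<sigma> x = \<eta> x}"

definition partition_fun :: "nat \<Rightarrow> real \<Rightarrow> (int ^ 'd) set \<Rightarrow> ((int ^ 'd) set \<Rightarrow> bool)
    \<Rightarrow> (int ^ 'd \<Rightarrow> real) \<Rightarrow> real" where
  "partition_fun q \<beta> \<Lambda> J \<eta> = (\<Sum>\<sigma> \<in> agreeing_configs q \<Lambda> \<eta>. exp (- \<beta> * hamiltonian \<Lambda> J \<sigma>))"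

text \<open>
  The sum of point masses on the finitely many configurations agreeing with \<open>\<eta>\<close> off \<open>\<Lambda>\<close>,
  pushed forward along the inclusion so that it lives on the \<open>\<sigma>\<close>-algebra of the whole
  configuration space.
\<close>

definition specification_measure :: "nat \<Rightarrow> real \<Rightarrow> (int ^ 'd) set \<Rightarrow> ((int ^ 'd) set \<Rightarrow> bool)
    \<Rightarrow> (int ^ 'd \<Rightarrow> real) \<Rightarrow> (int ^ 'd \<Rightarrow> real) measure" where
  "specification_measure q \<beta> \<Lambda> J \<eta> =
     distr
       (point_measure (agreeing_configs q \<Lambda> \<eta>)
          (\<lambda>\<sigma>. ennreal (exp (- \<beta> * hamiltonian \<Lambda> J \<sigma>) / partition_fun q \<beta> \<Lambda> J \<eta>)))
       (config_space q) (\<lambda>\<sigma>. \<sigma>)"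

definition local_function :: "nat \<Rightarrow> ((int ^ 'd \<Rightarrow> real) \<Rightarrow> real) \<Rightarrow> bool" where
  "local_function q f \<longleftrightarrow> (\<exists>\<Delta>. finite \<Delta> \<and>
     (\<forall>\<sigma> \<in> space (config_space q). \<forall>\<tau> \<in> space (config_space q).
        (\<forall>x \<in> \<Delta>. \<sigma> x = \<tau> x) \<longrightarrow> f \<sigma> = f \<tau>))"

definition gibbs_measures ::
  "nat \<Rightarrow> real \<Rightarrow> ((int ^ 'd) set \<Rightarrow> bool) \<Rightarrow> (int ^ 'd \<Rightarrow> real) measure set" where
  "gibbs_measures q \<beta> J = {\<mu>. prob_space \<mu> \<and> sets \<mu> = sets (config_space q) \<and>
     (\<forall>\<Lambda> f. finite \<Lambda> \<longrightarrow> local_function q f \<longrightarrow>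
        (\<integral>\<sigma>. f \<sigma> \<partial>\<mu>) = (\<integral>\<eta>. (\<integral>\<sigma>. f \<sigma> \<partial>specification_measure q \<beta> \<Lambda> J \<eta>) \<partial>\<mu>))}"

end

theory Submission
  imports Defs "HOL-Library.Diagonal_Subsequence"
begin

text \<open>
  Why the theorem holds.  Fix the boundary spin \<open>a\<close> outside a finite region \<open>\<Lambda>\<close>.  Every Boltzmann
  factor splits as
  \<open>exp (- \<beta> * (1 - cos \<theta>)) = (1 - \<epsilon>) * [\<theta> = 0] + \<rho> \<theta>\<close>,
  where \<open>\<epsilon>\<close> is the sum of the Boltzmann factors of the nonzero angles (\<open>misaligned_weight\<close>).
  Expanding the product over the edges amounts to a random-cluster representation: an edge that takes
  the first term forces its endpoints to agree.  With this choice of \<open>\<epsilon>\<close> the Fourier coefficients of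
  \<open>\<rho>\<close> (\<open>clock_weight_decomposition\<close>) are nonnegative and at most \<open>2 * \<epsilon> / q\<close>.  All functions of the
  spins that occur are then nonnegative combinations of cosines of integer combinations of the angles
  \<open>\<sigma>\<^sub>x - a\<close>.  Such functions (\<open>positive_type\<close>) are closed under products and satisfy correlation inequalities of Griffiths type, which replace the
  missing monotonicity of the clock model:

  \<^item> replacing the remainder \<open>\<rho>\<close> of an edge by the indicator that its endpoints agree costs at most
    a factor \<open>2 * \<epsilon>\<close> (\<open>sum_edge_remainder_le\<close>).  So each edge is aligned with conditional probability
    at least \<open>(1 - \<epsilon>) / (1 + \<epsilon>)\<close>, whatever is prescribed at the other edges;

  \<^item> a spin prefers the boundary value \<open>a\<close> to any other value \<open>b\<close>, also when it is not tied to the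
    boundary (\<open>sum_spin_bias_nonneg\<close>).

  Treating one edge at a time, these two facts give
  \<open>\<mu>(\<sigma>\<^sub>x = a) - \<mu>(\<sigma>\<^sub>x = b) \<ge> P(x is joined to the outside of \<Lambda>)\<close>,
  where the probability is that of Bernoulli(\<open>r\<close>) percolation on the edges with \<open>J = 1\<close>, for every
  density \<open>r\<close> up to the ratio above (\<open>spin_bias_ge_bernoulli_sum\<close>).

  As \<open>\<beta> \<rightarrow> \<infinity>\<close> that ratio tends to 1, so one can take \<open>r < 1\<close> with \<open>p * r > p\<^sub>c\<close>.  Thinning the
  disorder of density \<open>p\<close> by an independent one of density \<open>r\<close> gives density \<open>p * r\<close>
  (\<open>distr_thinning\<close>), which has an infinite cluster almost surely by the zero-one law.  Hence for almost
  every \<open>J\<close> there is a vertex \<open>x\<close> whose thinned cluster is infinite with positive probability \<open>c\<close>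
  (\<open>AE_ex_infinite_thinned_cluster\<close>), and the bias at \<open>x\<close> is at least \<open>c\<close> in every finite volume.

  The space of configurations is compact, so the finite-volume measures with boundary value \<open>a\<close> have
  a limit point along growing regions.  It is a Gibbs measure, and its bias at \<open>x\<close> towards \<open>a\<close> is again
  at least \<open>c > 0\<close> (\<open>gibbs_measure_exists_with_boundary\<close>).  Two of the \<open>q\<close> limits, for \<open>a \<noteq> b\<close>, cannot
  coincide, since one measure cannot prefer both \<open>a\<close> to \<open>b\<close> and \<open>b\<close> to \<open>a\<close>.
\<close>

section \<open>Lattice edges and open clusters\<close>

lemma countable_lattice_edges: "countable (lattice_edges :: (int ^ 'd::finite) set set)"
proof -
  have "lattice_edges \<subseteq> (\<lambda>(x, y). {x, y}) ` (UNIV :: ((int ^ 'd) \<times> (int ^ 'd)) set)"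
    by (auto simp: lattice_edges_def)
  then show ?thesis
    by (rule countable_subset) simp
qed

lemma finite_int_box: "finite {z :: int ^ 'd::finite. \<forall>i. \<bar>z $ i\<bar> \<le> n}"
proof -
  have "z \<in> vec_lambda ` (\<Pi>\<^sub>E i\<in>UNIV. {-n..n})" if "\<forall>i. \<bar>z $ i\<bar> \<le> n" for z :: "int ^ 'd"
    by (rule image_eqI[of _ _ "vec_nth z"]) (use that in \<open>auto simp: abs_le_iff minus_le_iff\<close>)
  moreover have "finite (vec_lambda ` (\<Pi>\<^sub>E i\<in>(UNIV :: 'd set). {-n..n}) :: (int ^ 'd) set)"
    by (intro finite_imageI finite_PiE) auto
  ultimately show ?thesis
    by (auto intro: finite_subset)
qed

text \<open>
  The two endpoints of an edge differ by at most 1 in each coordinate, so the edges at a given vertex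
  embed into a finite box.
\<close>

lemma finite_edges_touching:
  fixes \<Lambda> :: "(int ^ 'd::finite) set"
  assumes "finite \<Lambda>"
  shows "finite {e \<in> lattice_edges. e \<inter> \<Lambda> \<noteq> {}}"
proof -
  let ?B = "{z :: int ^ 'd. \<forall>i. \<bar>z $ i\<bar> \<le> 1}"
  have *: "y - x \<in> ?B" if "norm (\<chi> i. real_of_int (x $ i - y $ i)) = 1" for x y :: "int ^ 'd"
  proof -
    have "\<bar>real_of_int (x $ i - y $ i)\<bar> \<le> 1" for i
      using component_le_norm_cart[of "\<chi> i. real_of_int (x $ i - y $ i)" i] that by simp
    then have "\<bar>real_of_int (y $ i - x $ i)\<bar> \<le> 1" for i
      by (metis abs_minus_commute of_int_diff)
    then have "real_of_int \<bar>y $ i - x $ i\<bar> \<le> real_of_int 1" for i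
      by (simp only: of_int_abs of_int_1)
    then show ?thesis
      by (simp only: of_int_le_iff) simp
  qed
  have **: "norm (\<chi> i. real_of_int (x $ i - y $ i)) = norm (\<chi> i. real_of_int (y $ i - x $ i))"
    for x y :: "int ^ 'd"
    by (simp add: norm_vec_def abs_minus_commute)
  have "{e \<in> lattice_edges. e \<inter> \<Lambda> \<noteq> {}} \<subseteq> (\<lambda>(x, z). {x, x + z}) ` (\<Lambda> \<times> ?B)"
  proof
    fix e assume "e \<in> {e \<in> lattice_edges. e \<inter> \<Lambda> \<noteq> {}}"
    then obtain x y where xy: "e = {x, y}" "norm (\<chi> i. real_of_int (x $ i - y $ i)) = 1"
      and "x \<in> \<Lambda> \<or> y \<in> \<Lambda>"
      by (auto simp: lattice_edges_def)
    then show "e \<in> (\<lambda>(x, z). {x, x + z}) ` (\<Lambda> \<times> ?B)"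
    proof (elim disjE)
      assume "x \<in> \<Lambda>"
      then show ?thesis
        by (intro image_eqI[of _ _ "(x, y - x)"]) (use xy * in auto)
    next
      assume "y \<in> \<Lambda>"
      then show ?thesis
        using xy *[of y x] by (intro image_eqI[of _ _ "(y, x - y)"]) (auto simp del: of_int_diff simp: **[of y x])
    qed
  qed
  then show ?thesis
    using assms finite_int_box[of 1] by (rule finite_subset[OF _ finite_imageI[OF finite_cartesian_product]])
qed

lemma lattice_edgeE:
  assumes "e \<in> lattice_edges"
  obtains x y where "e = {x, y}"
  using assms by (auto simp: lattice_edges_def)

lemma open_cluster_refl: "x \<in> open_cluster J x"
  by (simp add: open_cluster_def)

lemma open_cluster_mono:
  assumes "\<And>e. e \<in> lattice_edges \<Longrightarrow> J e \<Longrightarrow> K e"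
  shows "open_cluster J x \<subseteq> open_cluster K x"
  unfolding open_cluster_def using assms by (intro Image_mono rtrancl_mono) auto

lemma open_cluster_cong:
  assumes "\<And>e. e \<in> lattice_edges \<Longrightarrow> J e = K e"
  shows "open_cluster J x = open_cluster K x"
  using assms by (intro antisym open_cluster_mono) auto

definition percolates :: "((int ^ 'd) set \<Rightarrow> bool) \<Rightarrow> bool" where
  "percolates J \<longleftrightarrow> (\<exists>x. infinite (open_cluster J x))"

text \<open>
  Connection is measurable because it is a countable union over path lengths and intermediate
  vertices.  The disorder enters through an arbitrary map \<open>g\<close>, so that the lemma applies to a thinned
  disorder, to one with some edges closed, and to \<open>\<sigma>\<close>-algebras smaller than that of the whole product.
\<close>

lemma pred_open_cluster:
  fixes g :: "'a \<Rightarrow> (int ^ 'd::finite) set \<Rightarrow> bool"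
  assumes "\<And>e. e \<in> lattice_edges \<Longrightarrow> Measurable.pred M (\<lambda>\<omega>. g \<omega> e)"
  shows "Measurable.pred M (\<lambda>\<omega>. y \<in> open_cluster (g \<omega>) x)"
proof -
  define R where "R \<omega> = {(u, v). {u, v} \<in> lattice_edges \<and> g \<omega> {u, v}}" for \<omega>
  have R: "Measurable.pred M (\<lambda>\<omega>. (u, v) \<in> R \<omega>)" for u v
    using assms by (cases "{u, v} \<in> lattice_edges") (auto simp: R_def)
  have "Measurable.pred M (\<lambda>\<omega>. (x, y) \<in> R \<omega> ^^ n)" for n
  proof (induction n arbitrary: y)
    case (Suc n)
    have "(\<lambda>\<omega>. (x, y) \<in> R \<omega> ^^ Suc n) = (\<lambda>\<omega>. \<exists>z. (x, z) \<in> R \<omega> ^^ n \<and> (z, y) \<in> R \<omega>)"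
      by (auto simp: relcomp_unfold)
    then show ?case
      using Suc R by simp
  qed auto
  then have "Measurable.pred M (\<lambda>\<omega>. \<exists>n. (x, y) \<in> R \<omega> ^^ n)"
    by simp
  also have "(\<lambda>\<omega>. \<exists>n. (x, y) \<in> R \<omega> ^^ n) = (\<lambda>\<omega>. y \<in> open_cluster (g \<omega>) x)"
    by (simp add: open_cluster_def R_def rtrancl_power)
  finally show ?thesis .
qed

lemma pred_infinite_open_cluster:
  fixes g :: "'a \<Rightarrow> (int ^ 'd::finite) set \<Rightarrow> bool"
  assumes "\<And>e. e \<in> lattice_edges \<Longrightarrow> Measurable.pred M (\<lambda>\<omega>. g \<omega> e)"
  shows "Measurable.pred M (\<lambda>\<omega>. infinite (open_cluster (g \<omega>) x))"
proof -
  have "infinite C \<longleftrightarrow> (\<forall>n::nat. \<exists>y. y \<in> C \<and> n < to_nat y)" for C :: "(int ^ 'd) set"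
  proof -
    have "infinite C \<longleftrightarrow> infinite (to_nat ` C)"
      using finite_image_iff[of to_nat C] by simp
    also have "\<dots> \<longleftrightarrow> (\<forall>n. \<exists>m>n. m \<in> to_nat ` C)"
      by (rule infinite_nat_iff_unbounded)
    finally show ?thesis
      by blast
  qed
  moreover have "Measurable.pred M (\<lambda>\<omega>. \<forall>n::nat. \<exists>y. y \<in> open_cluster (g \<omega>) x \<and> n < to_nat y)"
    by (intro pred_intros_countable pred_intros_logic pred_open_cluster assms) auto
  ultimately show ?thesis
    by simp
qed

lemma pred_percolates:
  fixes g :: "'a \<Rightarrow> (int ^ 'd::finite) set \<Rightarrow> bool"
  assumes "\<And>e. e \<in> lattice_edges \<Longrightarrow> Measurable.pred M (\<lambda>\<omega>. g \<omega> e)"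
  shows "Measurable.pred M (\<lambda>\<omega>. percolates (g \<omega>))"
  unfolding percolates_def
  by (intro pred_intros_countable pred_infinite_open_cluster assms)

text \<open>
  Closing one edge \<open>{u, v}\<close> splits the cluster of \<open>x\<close> into pieces that lie in the new clusters of
  \<open>x\<close>, \<open>u\<close> and \<open>v\<close>; if the old cluster is infinite, so is one of these three.
\<close>

lemma percolates_close_edge:
  fixes J :: "(int ^ 'd::finite) set \<Rightarrow> bool"
  assumes "percolates J"
  shows "percolates (\<lambda>e. J e \<and> e \<noteq> f)"
proof (cases "f \<in> lattice_edges")
  case False
  then have "open_cluster (\<lambda>e. J e \<and> e \<noteq> f) x = open_cluster J x" for x
    by (intro open_cluster_cong) auto
  with assms show ?thesis
    by (simp add: percolates_def)
next
  case True
  then obtain u v where f: "f = {u, v}"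
    by (rule lattice_edgeE)
  let ?C = "open_cluster (\<lambda>e. J e \<and> e \<noteq> f)"
  obtain x where x: "infinite (open_cluster J x)"
    using assms by (auto simp: percolates_def)
  have "y \<in> ?C x \<union> ?C u \<union> ?C v"
    if "(x, y) \<in> {(u, v). {u, v} \<in> lattice_edges \<and> J {u, v}}\<^sup>*" for y
    using that
  proof (induction rule: rtrancl_induct)
    case base
    then show ?case by (simp add: open_cluster_refl)
  next
    case (step y z)
    show ?case
    proof (cases "{y, z} = f")
      case True
      then have "z = u \<or> z = v"
        by (auto simp: f doubleton_eq_iff)
      then show ?thesis
        using open_cluster_refl[of u] open_cluster_refl[of v] by auto
    next
      case False
      with step.hyps have "(y, z) \<in> {(u, v). {u, v} \<in> lattice_edges \<and> J {u, v} \<and> {u, v} \<noteq> f}"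
        by auto
      with step.IH show ?thesis
        by (auto simp: open_cluster_def intro: rtrancl_into_rtrancl)
    qed
  qed
  then have "open_cluster J x \<subseteq> ?C x \<union> ?C u \<union> ?C v"
    by (auto simp: open_cluster_def)
  with x have "infinite (?C x \<union> ?C u \<union> ?C v)"
    using infinite_super by blast
  then show ?thesis
    unfolding percolates_def by auto
qed

lemma percolates_close_finitely_many:
  fixes J :: "(int ^ 'd::finite) set \<Rightarrow> bool"
  assumes "finite F"
  shows "percolates (\<lambda>e. J e \<and> e \<notin> F) \<longleftrightarrow> percolates J"
proof
  assume "percolates (\<lambda>e. J e \<and> e \<notin> F)"
  then show "percolates J"
    unfolding percolates_def
    using infinite_super[OF open_cluster_mono[of "\<lambda>e. J e \<and> e \<notin> F" J]] by auto
next
  assume J: "percolates J"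
  from assms show "percolates (\<lambda>e. J e \<and> e \<notin> F)"
  proof induction
    case empty
    then show ?case using J by simp
  next
    case (insert f F)
    then show ?case
      using percolates_close_edge[of "\<lambda>e. J e \<and> e \<notin> F" f] by (simp add: conj_ac)
  qed
qed

section \<open>The zero-one law for percolation\<close>

lemma space_disorder_law: "space (disorder_law p) = (\<Pi>\<^sub>E e\<in>lattice_edges. UNIV)"
  by (simp add: disorder_law_def space_PiM)

lemma prob_space_disorder_law: "prob_space (disorder_law p)"
  unfolding disorder_law_def by (intro prob_space_PiM measure_pmf.prob_space_axioms)

lemma pred_disorder_law:
  "e \<in> lattice_edges \<Longrightarrow> Measurable.pred (disorder_law p) (\<lambda>J. J e)"
  unfolding disorder_law_def by measurable

lemma indep_vars_disorder_law:
  "prob_space.indep_vars (disorder_law p) (\<lambda>_. measure_pmf (bernoulli_pmf p)) (\<lambda>e J. J e)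
    (lattice_edges :: (int ^ 'd::finite) set set)"
proof (cases "(lattice_edges :: (int ^ 'd::finite) set set) = {}")
  case True
  interpret prob_space "disorder_law p :: ((int ^ 'd) set \<Rightarrow> bool) measure"
    by (rule prob_space_disorder_law)
  show ?thesis
    using True by (simp add: indep_vars_def indep_sets_def)
next
  case False
  interpret prob_space "disorder_law p :: ((int ^ 'd) set \<Rightarrow> bool) measure"
    by (rule prob_space_disorder_law)
  let ?B = "\<lambda>_ :: (int ^ 'd) set. measure_pmf (bernoulli_pmf p)"
  have "distr (Pi\<^sub>M lattice_edges ?B) (Pi\<^sub>M lattice_edges ?B) (\<lambda>J. \<lambda>e\<in>lattice_edges. J e)
      = Pi\<^sub>M lattice_edges ?B"
    by (rule distr_cong[THEN trans, OF refl refl _ distr_id])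
       (auto simp: space_PiM PiE_restrict)
  moreover have "distr (Pi\<^sub>M lattice_edges ?B) (?B e) (\<lambda>J. J e) = ?B e" if "e \<in> lattice_edges" for e
    using that by (intro distr_PiM_component measure_pmf.prob_space_axioms) auto
  ultimately show ?thesis
    by (subst indep_vars_iff_distr_eq_PiM'[OF False])
       (auto simp: disorder_law_def intro!: PiM_cong)
qed

text \<open>
  By \<open>percolates_close_finitely_many\<close> percolation can be decided without looking at the first \<open>n\<close> edges
  of an enumeration, so it is a tail event and Kolmogorov's zero-one law applies.
\<close>

lemma disorder_law_percolates_zero_one:
  fixes p :: real
  defines "P \<equiv> disorder_law p :: ((int ^ 'd::finite) set \<Rightarrow> bool) measure"
  shows "(AE J in P. \<not> percolates J) \<or> (AE J in P. percolates J)"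
proof -
  interpret P: prob_space P
    unfolding P_def by (rule prob_space_disorder_law)
  let ?I = "lattice_edges :: (int ^ 'd) set set"
  let ?B = "\<lambda>_ :: (int ^ 'd) set. measure_pmf (bernoulli_pmf p)"
  define K where "K j = {e \<in> ?I. to_nat_on ?I e = j}" for j
  define A where "A j = sigma_sets (space P)
    {(\<lambda>J. restrict J (K j)) -` X \<inter> space P | X. X \<in> sets (Pi\<^sub>M (K j) ?B)}" for j
  define E where "E = {J \<in> space P. percolates J}"
  have A_space: "\<Union> (A ` S) \<subseteq> Pow (space P)" for S
    unfolding A_def
    by (intro UN_least subsetI PowI sigma_sets_into_sp) auto
  have "P.indep_vars (\<lambda>j. Pi\<^sub>M (K j) ?B) (\<lambda>j J. restrict (\<lambda>e. J e) (K j)) UNIV"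
    unfolding P_def
    by (rule prob_space.indep_vars_restrict[OF prob_space_disorder_law indep_vars_disorder_law])
       (auto simp: K_def disjoint_family_on_def)
  then have "P.indep_sets A UNIV"
    unfolding A_def P.indep_vars_def by simp
  moreover have "sigma_algebra (space P) (A j)" for j
    unfolding A_def by (intro sigma_algebra_sigma_sets) auto
  moreover have "E \<in> P.tail_events A"
    unfolding P.tail_events_def
  proof
    fix n
    define N where "N = sigma (space P) (\<Union> (A ` {n..}))"
    have N: "space N = space P" "sets N = sigma_sets (space P) (\<Union> (A ` {n..}))"
      using A_space by (simp_all add: N_def)
    \<comment> \<open>Closing the first \<open>n\<close> edges leaves the event unchanged and makes it a function of the later ones.\<close>
    define g where "g J e \<longleftrightarrow> J e \<and> e \<notin> {e \<in> ?I. to_nat_on ?I e < n}" for J e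
    have "finite {e \<in> ?I. to_nat_on ?I e < n}"
      by (rule finite_imageD[of "to_nat_on ?I"])
         (auto intro!: inj_on_subset[OF inj_on_to_nat_on[OF countable_lattice_edges]]
           finite_subset[of _ "{..<n}"])
    then have perc: "percolates (g J) \<longleftrightarrow> percolates J" for J
      unfolding g_def by (rule percolates_close_finitely_many)
    have "Measurable.pred N (\<lambda>J. g J e)" if e: "e \<in> ?I" for e
    proof (cases "to_nat_on ?I e < n")
      case True
      then show ?thesis using e by (simp add: g_def)
    next
      case False
      let ?j = "to_nat_on ?I e"
      let ?X = "{f \<in> space (Pi\<^sub>M (K ?j) ?B). f e}"
      have "?X \<in> sets (Pi\<^sub>M (K ?j) ?B)"
        using e by (intro sets_Collect_single') (auto simp: K_def)
      then have "(\<lambda>J. restrict J (K ?j)) -` ?X \<inter> space P \<in> A ?j"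
        unfolding A_def by (intro sigma_sets.Basic) blast
      also have "(\<lambda>J. restrict J (K ?j)) -` ?X \<inter> space P = {J \<in> space N. g J e}"
        using e False by (auto simp: N g_def K_def space_PiM)
      finally have "{J \<in> space N. g J e} \<in> sets N"
        unfolding N(2) using False by (intro sigma_sets.Basic) auto
      then show ?thesis
        by (simp add: pred_def)
    qed
    from pred_percolates[OF this]
    have "{J \<in> space N. percolates (g J)} \<in> sets N"
      by measurable
    then show "E \<in> sigma_sets (space P) (\<Union> (A ` {n..}))"
      by (simp add: perc N E_def)
  qed
  ultimately have "P.prob E = 0 \<or> P.prob E = 1"
    by (intro P.kolmogorov_0_1_law[of A]) auto
  moreover have E: "E \<in> P.events"
  proof -
    have "Measurable.pred P (\<lambda>J. percolates J)"
      unfolding P_def by (rule pred_percolates) (rule pred_disorder_law)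
    then show ?thesis
      by (simp add: E_def pred_def)
  qed
  ultimately show ?thesis
    using P.prob_eq_0[OF E] P.prob_eq_1[OF E] by (auto simp: E_def)
qed

section \<open>Thinning the disorder\<close>

lemma cylinder_in_sets:
  assumes "finite F" "F \<subseteq> lattice_edges"
  shows "{J \<in> space (disorder_law s). \<forall>e\<in>F. J e \<in> X e} \<in> sets (disorder_law s)"
proof (rule sets.sets_Collect_finite_All)
  fix e assume "e \<in> F"
  then show "{J \<in> space (disorder_law s). J e \<in> X e} \<in> sets (disorder_law s)"
    using assms unfolding disorder_law_def by (intro sets_Collect_single') auto
qed fact

lemma emeasure_cylinder:
  assumes "finite F" "F \<subseteq> lattice_edges"
  shows "emeasure (disorder_law s) {J \<in> space (disorder_law s). \<forall>e\<in>F. J e \<in> X e} =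
    (\<Prod>e\<in>F. emeasure (measure_pmf (bernoulli_pmf s)) (X e))"
proof -
  interpret product_prob_space "\<lambda>_. measure_pmf (bernoulli_pmf s)" lattice_edges
    by unfold_locales
  show ?thesis
    using assms unfolding disorder_law_def by (intro emeasure_PiM_Collect) auto
qed

text \<open>
  Independently for each edge, both coins show heads with probability \<open>p * r\<close>.  On a cylinder one first
  integrates over \<open>K\<close> for fixed \<open>J\<close>, which factorises over the edges, and then uses the independence of
  the coordinates of \<open>J\<close>.
\<close>

lemma distr_thinning:
  fixes p r :: real
  assumes p: "p \<in> {0..1}" and r: "r \<in> {0..1}"
  defines "P \<equiv> disorder_law :: real \<Rightarrow> ((int ^ 'd::finite) set \<Rightarrow> bool) measure"
  shows "distr (P p \<Otimes>\<^sub>M P r) (P (p * r)) (\<lambda>(J, K). \<lambda>e\<in>lattice_edges. J e \<and> K e) = P (p * r)"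
proof -
  let ?I = "lattice_edges :: (int ^ 'd) set set"
  let ?B = "\<lambda>s. measure_pmf (bernoulli_pmf s)"
  let ?T = "\<lambda>(J, K). \<lambda>e\<in>?I. J e \<and> K e"
  interpret P: prob_space "P s" for s
    unfolding P_def by (rule prob_space_disorder_law)
  have pr: "p * r \<in> {0..1}"
    using p r by (auto intro: mult_le_one)
  have T: "?T \<in> measurable (P p \<Otimes>\<^sub>M P r) (P s)" for s
    unfolding P_def disorder_law_def by measurable
  have "P (p * r) = distr (P p \<Otimes>\<^sub>M P r) (P (p * r)) ?T"
    unfolding P_def disorder_law_def[of "p * r"]
  proof (rule measure_eqI_PiM_infinite[OF refl], goal_cases)
    case 1
    show ?case by simp
  next
    case (2 A F)
    have emb: "prod_emb ?I (\<lambda>_. ?B s) F (Pi\<^sub>E F A) = {J \<in> space (P s). \<forall>e\<in>F. J e \<in> A e}" for s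
      using 2 unfolding prod_emb_def by (auto simp: P_def space_disorder_law space_PiM Pi_iff)
    have cyl: "{J \<in> space (P s). \<forall>e\<in>F. J e \<in> X e} \<in> sets (P s)" for s X
      unfolding P_def by (rule cylinder_in_sets) (use 2 in auto)
    have cyl_prob: "emeasure (P s) {J \<in> space (P s). \<forall>e\<in>F. J e \<in> X e} = (\<Prod>e\<in>F. emeasure (?B s) (X e))"
      for s X
      unfolding P_def by (rule emeasure_cylinder) (use 2 in auto)
    let ?S = "\<lambda>J. {K \<in> space (P r). \<forall>e\<in>F. K e \<in> {k. (J e \<and> k) \<in> A e}}"
    have indep: "prob_space.indep_vars (P p) (\<lambda>_. borel)
        (\<lambda>e J. emeasure (?B r) {k. (J e \<and> k) \<in> A e}) F"
      unfolding P_def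
      by (rule prob_space.indep_vars_compose2[OF prob_space_disorder_law
            prob_space.indep_vars_subset[OF prob_space_disorder_law indep_vars_disorder_law]])
         (use 2 in auto)
    have single: "(\<integral>\<^sup>+ J. emeasure (?B r) {k. (J e \<and> k) \<in> A e} \<partial>P p) = emeasure (?B (p * r)) (A e)"
      if "e \<in> F" for e
    proof -
      have "(\<integral>\<^sup>+ J. emeasure (?B r) {k. (J e \<and> k) \<in> A e} \<partial>P p) =
          (\<integral>\<^sup>+ j. emeasure (?B r) {k. (j \<and> k) \<in> A e} \<partial>distr (P p) (?B p) (\<lambda>J. J e))"
        using 2 that unfolding P_def disorder_law_def by (subst nn_integral_distr) auto
      also have "distr (P p) (?B p) (\<lambda>J. J e) = ?B p"
        using 2 that unfolding P_def disorder_law_def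
        by (intro distr_PiM_component measure_pmf.prob_space_axioms) auto
      also have "(\<integral>\<^sup>+ j. emeasure (?B r) {k. (j \<and> k) \<in> A e} \<partial>?B p) =
          ennreal (p * measure (?B r) {k. k \<in> A e} + (1 - p) * measure (?B r) {k. False \<in> A e})"
        using p by (simp add: measure_pmf.emeasure_eq_measure ennreal_mult' ennreal_plus mult.commute)
      also have "\<dots> = emeasure (?B (p * r)) (A e)"
      proof -
        have sets: "{k. k} = {True}" "{k. \<not> k} = {False}"
          by auto
        have "A e \<in> Pow {False, True}"
          by (simp flip: UNIV_bool)
        then have "A e \<in> {{}, {True}, {False}, UNIV}"
          unfolding UNIV_bool Pow_insert Pow_empty by auto
        then consider "A e = {}" | "A e = {True}" | "A e = {False}" | "A e = UNIV"
          by blast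
        then show ?thesis
        proof cases
          case 4
          then show ?thesis by simp
        qed (use p r pr in \<open>simp_all add: measure_pmf.emeasure_eq_measure sets measure_pmf_single algebra_simps\<close>)
      qed
      finally show ?thesis .
    qed
    have "emeasure (distr (P p \<Otimes>\<^sub>M P r) (P (p * r)) ?T) {J \<in> space (P (p * r)). \<forall>e\<in>F. J e \<in> A e} =
        emeasure (P p \<Otimes>\<^sub>M P r) (?T -` {J \<in> space (P (p * r)). \<forall>e\<in>F. J e \<in> A e} \<inter> space (P p \<Otimes>\<^sub>M P r))"
      using cyl T by (intro emeasure_distr) auto
    also have "\<dots> = (\<integral>\<^sup>+ J. emeasure (P r) (Pair J -`
        (?T -` {J \<in> space (P (p * r)). \<forall>e\<in>F. J e \<in> A e} \<inter> space (P p \<Otimes>\<^sub>M P r))) \<partial>P p)"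
      using measurable_sets[OF T cyl] by (intro P.emeasure_pair_measure_alt) auto
    also have "\<dots> = (\<integral>\<^sup>+ J. emeasure (P r) (?S J) \<partial>P p)"
    proof (intro nn_integral_cong arg_cong2[where f=emeasure] refl)
      fix J assume "J \<in> space (P p)"
      moreover have mem: "(\<lambda>e\<in>?I. J e \<and> K e) \<in> space (P s)" for K s
        by (simp add: P_def space_disorder_law)
      moreover have val: "(\<lambda>e\<in>?I. J e \<and> K e) e = (J e \<and> K e)" if "e \<in> F" for e K
        using 2 that by auto
      ultimately show "Pair J -` (?T -` {J \<in> space (P (p * r)). \<forall>e\<in>F. J e \<in> A e} \<inter> space (P p \<Otimes>\<^sub>M P r)) = ?S J"
        using 2 by (intro set_eqI) (auto simp: space_pair_measure)
    qed
    also have "\<dots> = (\<integral>\<^sup>+ J. (\<Prod>e\<in>F. emeasure (?B r) {k. (J e \<and> k) \<in> A e}) \<partial>P p)"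
      by (simp only: cyl_prob)
    also have "\<dots> = (\<Prod>e\<in>F. \<integral>\<^sup>+ J. emeasure (?B r) {k. (J e \<and> k) \<in> A e} \<partial>P p)"
      using 2 indep by (intro P.indep_vars_nn_integral) auto
    also have "\<dots> = (\<Prod>e\<in>F. emeasure (?B (p * r)) (A e))"
      by (intro prod.cong refl single)
    also have "\<dots> = emeasure (P (p * r)) {J \<in> space (P (p * r)). \<forall>e\<in>F. J e \<in> A e}"
      by (rule cyl_prob[symmetric])
    finally show ?case
      by (simp add: emb P_def disorder_law_def)
  next
    case 3
    show ?case using P.finite_measure_axioms[of "p * r"] by (simp add: P_def disorder_law_def)
  qed
  then show ?thesis ..
qed

text \<open>
  Above the supremum that defines the critical probability it is not almost sure that there is no infinite
  cluster; by the zero-one law there then almost surely is one.  Fubini turns this statement about the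
  thinned disorder into one about almost every \<open>J\<close> and almost every \<open>K\<close>.
\<close>

lemma AE_thinning_percolates:
  fixes p r :: real
  assumes p: "p \<in> {0..1}" and r: "r \<in> {0..1}" and supercritical: "p * r > critical_prob TYPE('d::finite)"
  shows "AE J in (disorder_law p :: ((int ^ 'd) set \<Rightarrow> bool) measure).
    AE K in disorder_law r. percolates (\<lambda>e. J e \<and> K e)"
proof -
  let ?P = "disorder_law :: real \<Rightarrow> ((int ^ 'd) set \<Rightarrow> bool) measure"
  let ?T = "\<lambda>(J, K). \<lambda>e\<in>lattice_edges. J e \<and> K e"
  interpret P: prob_space "?P s" for s
    by (rule prob_space_disorder_law)
  interpret PP: pair_prob_space "?P p" "?P r" ..
  have pr: "p * r \<in> {0..1}"
    using p r by (auto intro: mult_le_one)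
  have "\<not> (AE J in ?P (p * r). \<not> percolates J)"
  proof
    assume "AE J in ?P (p * r). \<not> percolates J"
    then have "p * r \<le> critical_prob TYPE('d)"
      unfolding critical_prob_def percolates_def using pr by (intro cSup_upper bdd_aboveI[of _ 1]) auto
    with supercritical show False by simp
  qed
  then have "AE J in ?P (p * r). percolates J"
    using disorder_law_percolates_zero_one by blast
  then have "AE J in distr (?P p \<Otimes>\<^sub>M ?P r) (?P (p * r)) ?T. percolates J"
    unfolding distr_thinning[OF p r] .
  moreover have "?T \<in> measurable (?P p \<Otimes>\<^sub>M ?P r) (?P (p * r))"
    unfolding disorder_law_def by measurable
  ultimately have "AE \<omega> in ?P p \<Otimes>\<^sub>M ?P r. percolates (?T \<omega>)"
    by (rule AE_distrD[rotated])
  then have "AE J in ?P p. AE K in ?P r. percolates (?T (J, K))"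
    by (rule PP.AE_pair)
  moreover have "percolates (?T (J, K)) \<longleftrightarrow> percolates (\<lambda>e. J e \<and> K e)"
    for J K :: "(int ^ 'd) set \<Rightarrow> bool"
    unfolding percolates_def
    by (intro ex_cong1 arg_cong[where f=infinite] open_cluster_cong) auto
  ultimately show ?thesis
    by simp
qed

text \<open>
  A countable union over \<open>x\<close>: if every \<open>x\<close> had an infinite thinned cluster with probability zero, there
  would almost surely be none.
\<close>

lemma AE_ex_infinite_thinned_cluster:
  fixes p r :: real
  assumes p: "p \<in> {0..1}" and r: "r \<in> {0..1}" and supercritical: "p * r > critical_prob TYPE('d::finite)"
  shows "AE J in (disorder_law p :: ((int ^ 'd) set \<Rightarrow> bool) measure).
    \<exists>x. 0 < measure (disorder_law r)
      {K \<in> space (disorder_law r). infinite (open_cluster (\<lambda>e. J e \<and> K e) x)}"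
  using AE_thinning_percolates[OF assms]
proof (eventually_elim)
  case (elim J)
  let ?Q = "disorder_law r :: ((int ^ 'd) set \<Rightarrow> bool) measure"
  interpret Q: prob_space ?Q
    by (rule prob_space_disorder_law)
  let ?E = "\<lambda>x. {K \<in> space ?Q. infinite (open_cluster (\<lambda>e. J e \<and> K e) x)}"
  have E: "?E x \<in> sets ?Q" for x
  proof -
    have "Measurable.pred ?Q (\<lambda>K. infinite (open_cluster (\<lambda>e. J e \<and> K e) x))"
      by (rule pred_infinite_open_cluster) (intro pred_intros_logic pred_disorder_law, auto)
    then show ?thesis
      by (simp add: pred_def)
  qed
  show ?case
  proof (rule ccontr)
    assume "\<not> ?thesis"
    then have "Q.prob (?E x) = 0" for x
      by (simp add: not_less antisym measure_nonneg)
    then have "AE K in ?Q. K \<notin> ?E x" for x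
      using Q.prob_eq_0[OF E] by blast
    then have "AE K in ?Q. \<forall>x. K \<notin> ?E x"
      by (simp add: AE_all_countable)
    with elim have "AE K in ?Q. False"
      using AE_space by eventually_elim (auto simp: percolates_def)
    then show False
      using Q.AE_False by simp
  qed
qed

section \<open>Bernoulli percolation on a finite edge set\<close>

text \<open>
  For finite \<open>U\<close> and \<open>r\<close> in \<open>[0, 1]\<close>, the probability that a random subset of \<open>U\<close>, containing each
  element independently with probability \<open>r\<close>, satisfies \<open>\<phi>\<close>.  As a finite sum it can be conditioned on one element by
  algebra alone, which is what the induction over edges needs.
\<close>

definition bernoulli_sum :: "real \<Rightarrow> 'e set \<Rightarrow> ('e set \<Rightarrow> bool) \<Rightarrow> real" where
  "bernoulli_sum r U \<phi> = (\<Sum>\<xi>\<in>Pow U. r ^ card \<xi> * (1 - r) ^ card (U - \<xi>) * of_bool (\<phi> \<xi>))"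

lemma bernoulli_sum_empty: "bernoulli_sum r {} \<phi> = of_bool (\<phi> {})"
  by (simp add: bernoulli_sum_def)

lemma bernoulli_sum_insert:
  assumes "finite U" "e \<notin> U"
  shows "bernoulli_sum r (insert e U) \<phi> =
    r * bernoulli_sum r U (\<lambda>\<xi>. \<phi> (insert e \<xi>)) + (1 - r) * bernoulli_sum r U \<phi>"
proof -
  let ?g = "\<lambda>\<xi>. r ^ card \<xi> * (1 - r) ^ card (insert e U - \<xi>) * of_bool (\<phi> \<xi>)"
  have inj: "inj_on (insert e) (Pow U)"
    using assms by (auto simp: inj_on_def)
  have "bernoulli_sum r (insert e U) \<phi> = sum ?g (Pow U) + sum ?g (insert e ` Pow U)"
    unfolding bernoulli_sum_def Pow_insert using assms by (intro sum.union_disjoint) auto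
  also have "sum ?g (Pow U) = (1 - r) * bernoulli_sum r U \<phi>"
    unfolding bernoulli_sum_def sum_distrib_left
  proof (intro sum.cong refl)
    fix \<xi> assume "\<xi> \<in> Pow U"
    then have "insert e U - \<xi> = insert e (U - \<xi>)" using assms by auto
    then show "?g \<xi> = (1 - r) * (r ^ card \<xi> * (1 - r) ^ card (U - \<xi>) * of_bool (\<phi> \<xi>))"
      using assms by simp
  qed
  also have "sum ?g (insert e ` Pow U) = (\<Sum>\<xi>\<in>Pow U. ?g (insert e \<xi>))"
    using inj by (simp add: sum.reindex)
  also have "\<dots> = r * bernoulli_sum r U (\<lambda>\<xi>. \<phi> (insert e \<xi>))"
    unfolding bernoulli_sum_def sum_distrib_left
  proof (intro sum.cong refl)
    fix \<xi> assume "\<xi> \<in> Pow U"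
    then have "insert e U - insert e \<xi> = U - \<xi>" "e \<notin> \<xi>" "finite \<xi>"
      using assms by (auto intro: finite_subset)
    then show "?g (insert e \<xi>) = r * (r ^ card \<xi> * (1 - r) ^ card (U - \<xi>) * of_bool (\<phi> (insert e \<xi>)))"
      by simp
  qed
  finally show ?thesis
    by simp
qed

lemma bernoulli_sum_mono:
  assumes "r \<in> {0..1}" "\<And>\<xi>. \<phi> \<xi> \<Longrightarrow> \<psi> \<xi>"
  shows "bernoulli_sum r U \<phi> \<le> bernoulli_sum r U \<psi>"
  unfolding bernoulli_sum_def using assms by (intro sum_mono mult_left_mono) auto

text \<open>
  An event that depends on the edges in \<open>U\<close> only is split into cylinders according to the set \<open>\<xi>\<close> of open
  edges of \<open>U\<close>; the singleton \<open>{e \<in> \<xi>}\<close> is a set of truth values.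
\<close>

lemma finite_disorder_event_eq:
  "{K \<in> A. \<phi> {e \<in> U. K e}} = (\<Union>\<xi>\<in>{\<xi> \<in> Pow U. \<phi> \<xi>}. {K \<in> A. \<forall>e\<in>U. K e \<in> {e \<in> \<xi>}})"
proof (intro set_eqI iffI)
  fix K assume "K \<in> {K \<in> A. \<phi> {e \<in> U. K e}}"
  then show "K \<in> (\<Union>\<xi>\<in>{\<xi> \<in> Pow U. \<phi> \<xi>}. {K \<in> A. \<forall>e\<in>U. K e \<in> {e \<in> \<xi>}})"
    by (intro UN_I[of "{e \<in> U. K e}"]) auto
next
  fix K assume "K \<in> (\<Union>\<xi>\<in>{\<xi> \<in> Pow U. \<phi> \<xi>}. {K \<in> A. \<forall>e\<in>U. K e \<in> {e \<in> \<xi>}})"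
  then obtain \<xi> where \<xi>: "\<xi> \<subseteq> U" "\<phi> \<xi>" "K \<in> A" "\<forall>e\<in>U. K e = (e \<in> \<xi>)"
    by auto
  then have "{e \<in> U. K e} = \<xi>"
    by blast
  with \<xi> show "K \<in> {K \<in> A. \<phi> {e \<in> U. K e}}"
    by simp
qed

lemma finite_disorder_event_in_sets:
  assumes "finite U" "U \<subseteq> lattice_edges"
  shows "{K \<in> space (disorder_law r). \<phi> {e \<in> U. K e}} \<in> sets (disorder_law r)"
  unfolding finite_disorder_event_eq
  using assms by (intro sets.finite_UN cylinder_in_sets) auto

lemma measure_finite_disorder_event:
  assumes U: "finite U" "U \<subseteq> lattice_edges" and r: "r \<in> {0..1}"
  shows "measure (disorder_law r) {K \<in> space (disorder_law r). \<phi> {e \<in> U. K e}} = bernoulli_sum r U \<phi>"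
proof -
  let ?Q = "disorder_law r"
  interpret Q: prob_space ?Q
    by (rule prob_space_disorder_law)
  let ?C = "\<lambda>\<xi>. {K \<in> space ?Q. \<forall>e\<in>U. K e \<in> {e \<in> \<xi>}}"
  have C: "measure ?Q (?C \<xi>) = r ^ card \<xi> * (1 - r) ^ card (U - \<xi>)" if "\<xi> \<subseteq> U" for \<xi>
  proof -
    have "emeasure ?Q (?C \<xi>) = (\<Prod>e\<in>U. emeasure (measure_pmf (bernoulli_pmf r)) {e \<in> \<xi>})"
      using U by (rule emeasure_cylinder)
    also have "\<dots> = (\<Prod>e\<in>U. ennreal (if e \<in> \<xi> then r else 1 - r))"
      using r by (intro prod.cong) (auto simp: emeasure_pmf_single)
    also have "\<dots> = ennreal (\<Prod>e\<in>U. if e \<in> \<xi> then r else 1 - r)"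
      using r by (intro prod_ennreal) auto
    also have "(\<Prod>e\<in>U. if e \<in> \<xi> then r else 1 - r) = r ^ card \<xi> * (1 - r) ^ card (U - \<xi>)"
    proof -
      have "U \<inter> {e. e \<in> \<xi>} = \<xi>" "U \<inter> - {e. e \<in> \<xi>} = U - \<xi>"
        using that by auto
      then show ?thesis
        using U(1) by (simp add: prod.If_cases)
    qed
    finally show ?thesis
      using r by (simp add: measure_def)
  qed
  have "measure ?Q {K \<in> space ?Q. \<phi> {e \<in> U. K e}} = (\<Sum>\<xi>\<in>{\<xi> \<in> Pow U. \<phi> \<xi>}. measure ?Q (?C \<xi>))"
    unfolding finite_disorder_event_eq
  proof (rule Q.finite_measure_finite_Union)
    show "disjoint_family_on ?C {\<xi> \<in> Pow U. \<phi> \<xi>}"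
      unfolding disjoint_family_on_def by blast
    show "?C ` {\<xi> \<in> Pow U. \<phi> \<xi>} \<subseteq> Q.events"
      by (intro image_subsetI cylinder_in_sets U)
  qed (use U in auto)
  also have "\<dots> = bernoulli_sum r U \<phi>"
    unfolding bernoulli_sum_def using U(1) C
    by (intro sum.mono_neutral_cong_left) auto
  finally show ?thesis .
qed

definition escapes :: "'v set \<Rightarrow> 'v \<Rightarrow> 'v set set \<Rightarrow> bool" where
  "escapes \<Lambda> x D \<longleftrightarrow> (\<exists>y. y \<notin> \<Lambda> \<and> (x, y) \<in> {(u, v). {u, v} \<in> D}\<^sup>*)"

lemma escapes_mono: "escapes \<Lambda> x D \<Longrightarrow> D \<subseteq> D' \<Longrightarrow> escapes \<Lambda> x D'"
proof -
  assume "D \<subseteq> D'"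
  then have "{(u, v). {u, v} \<in> D}\<^sup>* \<subseteq> {(u, v). {u, v} \<in> D'}\<^sup>*"
    by (intro rtrancl_mono) auto
  then show "escapes \<Lambda> x D \<Longrightarrow> escapes \<Lambda> x D'"
    unfolding escapes_def by blast
qed

text \<open>
  Up to its first exit from \<open>\<Lambda>\<close>, a path uses only edges that touch \<open>\<Lambda>\<close>.
\<close>

lemma infinite_cluster_escapes:
  assumes "finite \<Lambda>" and "infinite (open_cluster L x)"
  shows "escapes \<Lambda> x {e \<in> lattice_edges. e \<inter> \<Lambda> \<noteq> {} \<and> L e}"
proof (rule ccontr)
  let ?R = "{(u, v). {u, v} \<in> {e \<in> lattice_edges. e \<inter> \<Lambda> \<noteq> {} \<and> L e}}"
  assume "\<not> ?thesis"
  then have stay: "y \<in> \<Lambda>" if "(x, y) \<in> ?R\<^sup>*" for y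
    using that unfolding escapes_def by blast
  have "(x, y) \<in> ?R\<^sup>*" if "(x, y) \<in> {(u, v). {u, v} \<in> lattice_edges \<and> L {u, v}}\<^sup>*" for y
    using that
  proof (induction rule: rtrancl_induct)
    case (step y z)
    then have "(y, z) \<in> ?R"
      using stay[OF step.IH] by simp
    with step.IH show ?case
      by (rule rtrancl_into_rtrancl)
  qed auto
  with stay have "open_cluster L x \<subseteq> \<Lambda>"
    unfolding open_cluster_def by (intro subsetI) (simp only: Image_singleton_iff)
  with assms show False
    using finite_subset by blast
qed

lemma infinite_cluster_prob_le:
  fixes \<Lambda> :: "(int ^ 'd::finite) set"
  assumes \<Lambda>: "finite \<Lambda>" and r: "r \<in> {0..1}"
  shows "measure (disorder_law r) {K \<in> space (disorder_law r). infinite (open_cluster (\<lambda>e. J e \<and> K e) x)}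
    \<le> bernoulli_sum r {e \<in> lattice_edges. e \<inter> \<Lambda> \<noteq> {} \<and> J e} (escapes \<Lambda> x)"
proof -
  let ?Q = "disorder_law r :: ((int ^ 'd) set \<Rightarrow> bool) measure"
  interpret Q: prob_space ?Q
    by (rule prob_space_disorder_law)
  let ?U = "{e \<in> lattice_edges. e \<inter> \<Lambda> \<noteq> {} \<and> J e}"
  have U: "finite ?U"
    using finite_edges_touching[OF \<Lambda>] by (rule rev_finite_subset) auto
  have "escapes \<Lambda> x {e \<in> ?U. K e}" if "infinite (open_cluster (\<lambda>e. J e \<and> K e) x)" for K
  proof -
    have "{e \<in> ?U. K e} = {e \<in> lattice_edges. e \<inter> \<Lambda> \<noteq> {} \<and> J e \<and> K e}"
      by auto
    then show ?thesis
      using infinite_cluster_escapes[OF \<Lambda> that] by simp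
  qed
  then have "{K \<in> space ?Q. infinite (open_cluster (\<lambda>e. J e \<and> K e) x)}
      \<subseteq> {K \<in> space ?Q. escapes \<Lambda> x {e \<in> ?U. K e}}"
    by blast
  then have "measure ?Q {K \<in> space ?Q. infinite (open_cluster (\<lambda>e. J e \<and> K e) x)}
      \<le> measure ?Q {K \<in> space ?Q. escapes \<Lambda> x {e \<in> ?U. K e}}"
    using U by (intro Q.finite_measure_mono finite_disorder_event_in_sets) auto
  also have "\<dots> = bernoulli_sum r ?U (escapes \<Lambda> x)"
    using U r by (intro measure_finite_disorder_event) auto
  finally show ?thesis .
qed

section \<open>Fourier decomposition of the clock weight\<close>

lemma finite_spin_set: "finite (spin_set q)"
  by (simp add: spin_set_def)

lemma spin_setE:
  assumes "s \<in> spin_set q"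
  obtains i where "i < q" "s = 2 * pi * real i / real q"
  using assms by (auto simp: spin_set_def)

lemma inj_on_spin: "inj_on (\<lambda>i. 2 * pi * real i / real q) {..<q}"
  by (auto simp: inj_on_def)

lemma sum_roots_of_unity:
  fixes n :: int
  assumes "q > 0"
  shows "(\<Sum>k<q. cis (2 * pi * real_of_int n * real k / real q)) = (if int q dvd n then of_nat q else 0)"
proof (cases "int q dvd n")
  case True
  then obtain m where m: "n = int q * m" ..
  have "cis (2 * pi * real_of_int n * real k / real q) = 1" for k
  proof -
    have "2 * pi * real_of_int n * real k / real q = 2 * pi * real_of_int (m * int k)"
      using assms by (simp add: m)
    then show ?thesis
      by (simp only: cis_multiple_2pi Ints_of_int)
  qed
  with True show ?thesis
    by simp
next
  case False
  define z where "z = cis (2 * pi * real_of_int n / real q)"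
  have pow: "cis (2 * pi * real_of_int n * real k / real q) = z ^ k" for k
  proof -
    have "2 * pi * real_of_int n * real k / real q = real k * (2 * pi * real_of_int n / real q)"
      by simp
    then show ?thesis
      by (simp only: z_def Complex.DeMoivre)
  qed
  have "z ^ q = 1"
    using assms by (simp flip: pow add: cis_multiple_2pi)
  moreover have "z \<noteq> 1"
  proof
    assume "z = 1"
    then have "cos (2 * pi * real_of_int n / real q) = 1"
      by (simp add: z_def complex_eq_iff)
    then obtain m where "2 * pi * real_of_int n / real q = real_of_int m * 2 * pi"
      using cos_one_2pi_int by auto
    then have "real_of_int n = real_of_int (m * int q)"
      using assms by (simp add: field_simps)
    then have "n = m * int q"
      by (simp only: of_int_eq_iff)
    with False show False
      by simp
  qed
  ultimately show ?thesis
    using False by (simp add: pow sum_gp_strict)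
qed

lemma sum_cos_roots_of_unity:
  fixes n :: int
  assumes "q > 0"
  shows "(\<Sum>k<q. cos (2 * pi * real_of_int n * real k / real q)) = (if int q dvd n then real q else 0)"
  using arg_cong[OF sum_roots_of_unity[OF assms, of n], of Re] by auto

lemma sum_cos_spin_difference:
  assumes "s \<in> spin_set q" "t \<in> spin_set q"
  shows "(\<Sum>k<q. cos (real k * (s - t))) = real q * of_bool (s = t)"
proof -
  from assms obtain i j where i: "i < q" "s = 2 * pi * real i / real q"
    and j: "j < q" "t = 2 * pi * real j / real q"
    by (auto elim!: spin_setE)
  have "real k * (s - t) = 2 * pi * real_of_int (int i - int j) * real k / real q" for k
    by (simp add: i j diff_divide_distrib algebra_simps)
  then have "(\<Sum>k<q. cos (real k * (s - t))) = (if int q dvd int i - int j then real q else 0)"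
    using sum_cos_roots_of_unity[of q "int i - int j"] i by simp
  moreover have "int q dvd int i - int j \<longleftrightarrow> i = j"
    using i(1) j(1) zdvd_imp_le[of "int q" "\<bar>int i - int j\<bar>"] by (cases "i = j") auto
  moreover have "s = t \<longleftrightarrow> i = j"
    using i j by auto
  ultimately show ?thesis
    by simp
qed

text \<open>
  The angles are indexed by integers, so that equality of angles modulo \<open>2 * pi\<close> becomes divisibility of
  the index by \<open>q\<close>.
\<close>

definition clock_weight :: "nat \<Rightarrow> real \<Rightarrow> int \<Rightarrow> real" where
  "clock_weight q \<beta> n = exp (- \<beta> * (1 - cos (2 * pi * real_of_int n / real q)))"

text \<open>
  The quantity \<open>\<epsilon>\<close> of the introduction.  If this mass is left at angle 0, it can be divided among the nonzero
  angles so that each of them contributes a nonnegative multiple of \<open>1 + cos (2 * pi * j * k / q)\<close> to the \<open>k\<close>-th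
  Fourier coefficient of the rest.
\<close>

definition misaligned_weight :: "nat \<Rightarrow> real \<Rightarrow> real" where
  "misaligned_weight q \<beta> = (\<Sum>j\<in>{1..<q}. clock_weight q \<beta> (int j))"

text \<open>
  The \<open>k\<close>-th Fourier coefficient of the part of the weight that is left after removing
  \<open>1 - \<epsilon>\<close> at angle 0.  The summand 1 comes from the mass \<open>\<epsilon>\<close> that stays at angle 0, the cosine
  from the nonzero angles.
\<close>

definition remainder_coeff :: "nat \<Rightarrow> real \<Rightarrow> nat \<Rightarrow> real" where
  "remainder_coeff q \<beta> k =
    (\<Sum>j\<in>{1..<q}. clock_weight q \<beta> (int j) * (1 + cos (2 * pi * real j * real k / real q))) / real q"

lemma remainder_coeff_nonneg: "0 \<le> remainder_coeff q \<beta> k"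
  unfolding remainder_coeff_def
  by (intro divide_nonneg_nonneg sum_nonneg mult_nonneg_nonneg)
     (auto simp: clock_weight_def intro: order_trans[OF _ add_left_mono[OF cos_ge_minus_one]])

lemma remainder_coeff_le: "remainder_coeff q \<beta> k \<le> 2 * misaligned_weight q \<beta> / real q"
proof -
  have "(\<Sum>j\<in>{1..<q}. clock_weight q \<beta> (int j) * (1 + cos (2 * pi * real j * real k / real q)))
      \<le> (\<Sum>j\<in>{1..<q}. clock_weight q \<beta> (int j) * 2)"
    by (intro sum_mono mult_left_mono)
       (auto simp: clock_weight_def intro: order_trans[OF add_left_mono[OF cos_le_one]])
  then show ?thesis
    unfolding remainder_coeff_def misaligned_weight_def
    by (intro divide_right_mono) (simp_all add: sum_distrib_left mult.commute)
qed

lemma clock_weight_minus: "clock_weight q \<beta> (- n) = clock_weight q \<beta> n"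
  by (simp add: clock_weight_def)

lemma clock_weight_periodic:
  assumes "q > 0" "int q dvd n - m"
  shows "clock_weight q \<beta> n = clock_weight q \<beta> m"
proof -
  obtain l where "n - m = int q * l"
    using assms(2) ..
  then have "n = m + int q * l"
    by simp
  then have "2 * pi * real_of_int n / real q = 2 * pi * real_of_int m / real q + 2 * pi * real_of_int l"
    using assms(1) by (simp add: field_simps)
  then have "cos (2 * pi * real_of_int n / real q) = cos (2 * pi * real_of_int m / real q)"
    by (simp add: cos_add)
  then show ?thesis
    by (simp add: clock_weight_def)
qed

text \<open>
  Exactly one \<open>j\<close> in \<open>{0..<q}\<close> is congruent to \<open>n\<close>, and it is excluded from the sum precisely when \<open>q\<close> divides
  \<open>n\<close>.
\<close>

lemma sum_clock_weight_residue:
  assumes "q > 0"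
  shows "(\<Sum>j\<in>{1..<q}. clock_weight q \<beta> (int j) * of_bool (int q dvd n - int j)) =
    of_bool (\<not> int q dvd n) * clock_weight q \<beta> n"
proof -
  let ?r = "nat (n mod int q)"
  have r: "int ?r = n mod int q" "?r < q"
    using assms by (auto simp: nat_less_iff)
  have iff: "int q dvd n - int j \<longleftrightarrow> j = ?r" if "j \<in> {1..<q}" for j
  proof -
    have "int q dvd n - int j \<longleftrightarrow> n mod int q = int j mod int q"
      by (simp add: mod_eq_dvd_iff)
    also have "int j mod int q = int j"
      using that by simp
    finally show ?thesis
      using r by linarith
  qed
  have "(\<Sum>j\<in>{1..<q}. clock_weight q \<beta> (int j) * of_bool (int q dvd n - int j)) =
      (\<Sum>j\<in>{1..<q}. if j = ?r then clock_weight q \<beta> (int j) else 0)"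
    by (intro sum.cong) (auto simp: iff)
  also have "\<dots> = (if ?r \<in> {1..<q} then clock_weight q \<beta> (int ?r) else 0)"
    by (subst sum.delta) auto
  also have "?r \<in> {1..<q} \<longleftrightarrow> \<not> int q dvd n"
  proof -
    have "0 \<le> n mod int q"
      using assms by simp
    then have "0 < ?r \<longleftrightarrow> n mod int q \<noteq> 0"
      by (simp only: zero_less_nat_eq) linarith
    then show ?thesis
      using r(2) by (simp add: dvd_eq_mod_eq_0 Suc_le_eq del: zero_less_nat_eq)
  qed
  also have "clock_weight q \<beta> (int ?r) = clock_weight q \<beta> n"
    using assms by (intro clock_weight_periodic) (auto simp: r mod_eq_dvd_iff[symmetric])
  finally show ?thesis
    by simp
qed

text \<open>
  Summing over \<open>k\<close> first, the product-to-sum formula and orthogonality of the characters turn the terms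
  of \<open>remainder_coeff\<close> into the indicators of \<open>n = 0\<close>, \<open>n = j\<close> and \<open>n = - j\<close> modulo \<open>q\<close>, the last two with
  weight one half.  Since the weight is even, the two halves add up to the weight at \<open>n\<close>.
\<close>

lemma clock_weight_decomposition:
  assumes "q > 0"
  shows "clock_weight q \<beta> n = (1 - misaligned_weight q \<beta>) * of_bool (int q dvd n)
    + (\<Sum>k<q. remainder_coeff q \<beta> k * cos (2 * pi * real_of_int n * real k / real q))"
proof -
  let ?c = "\<lambda>n k. cos (2 * pi * real_of_int n * real k / real q)"
  let ?w = "clock_weight q \<beta>"
  have cc: "(\<Sum>k<q. (1 + ?c (int j) k) * ?c n k) =
      real q * (of_bool (int q dvd n) + of_bool (int q dvd n - int j) / 2 + of_bool (int q dvd - n - int j) / 2)"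
    for j
  proof -
    have "(1 + ?c (int j) k) * ?c n k = ?c n k + ?c (n - int j) k / 2 + ?c (n + int j) k / 2" for k
    proof -
      have "?c (n - int j) k + ?c (n + int j) k = 2 * ?c (int j) k * ?c n k"
      proof -
        have "2 * pi * real_of_int (n - int j) * real k / real q
            = 2 * pi * real_of_int n * real k / real q - 2 * pi * real_of_int (int j) * real k / real q"
          "2 * pi * real_of_int (n + int j) * real k / real q
            = 2 * pi * real_of_int n * real k / real q + 2 * pi * real_of_int (int j) * real k / real q"
          by (simp_all add: diff_divide_distrib add_divide_distrib algebra_simps)
        then show ?thesis
          by (simp only: cos_add cos_diff) simp
      qed
      then show ?thesis
        by (simp add: algebra_simps)
    qed
    then have "(\<Sum>k<q. (1 + ?c (int j) k) * ?c n k) =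
        (\<Sum>k<q. ?c n k) + (\<Sum>k<q. ?c (n - int j) k) / 2 + (\<Sum>k<q. ?c (n + int j) k) / 2"
      by (simp only: sum.distrib sum_divide_distrib)
    moreover have "int q dvd n + int j \<longleftrightarrow> int q dvd - n - int j"
      using dvd_minus_iff[of "int q" "n + int j"] by simp
    ultimately show ?thesis
      by (simp only: sum_cos_roots_of_unity[OF assms]) (simp add: algebra_simps)
  qed
  have "(\<Sum>k<q. remainder_coeff q \<beta> k * ?c n k) =
      (\<Sum>k<q. \<Sum>j\<in>{1..<q}. ?w (int j) * ((1 + ?c (int j) k) * ?c n k)) / real q"
    unfolding remainder_coeff_def sum_divide_distrib sum_distrib_right
    by (intro sum.cong refl) (simp add: field_simps)
  also have "\<dots> = (\<Sum>j\<in>{1..<q}. ?w (int j) * (\<Sum>k<q. (1 + ?c (int j) k) * ?c n k)) / real q"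
    by (subst sum.swap) (simp only: sum_distrib_left)
  also have "\<dots> = (\<Sum>j\<in>{1..<q}. ?w (int j) *
      (of_bool (int q dvd n) + of_bool (int q dvd n - int j) / 2 + of_bool (int q dvd - n - int j) / 2))"
    unfolding cc sum_divide_distrib using assms by (intro sum.cong) auto
  also have "\<dots> = misaligned_weight q \<beta> * of_bool (int q dvd n)
      + (\<Sum>j\<in>{1..<q}. ?w (int j) * of_bool (int q dvd n - int j)) / 2
      + (\<Sum>j\<in>{1..<q}. ?w (int j) * of_bool (int q dvd - n - int j)) / 2"
    unfolding misaligned_weight_def sum_distrib_right sum_divide_distrib
    by (simp only: sum.distrib[symmetric]) (simp add: algebra_simps)
  also have "\<dots> = misaligned_weight q \<beta> * of_bool (int q dvd n) + of_bool (\<not> int q dvd n) * ?w n"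
    unfolding sum_clock_weight_residue[OF assms] by (simp add: clock_weight_minus)
  finally have *: "(\<Sum>k<q. remainder_coeff q \<beta> k * ?c n k) =
      misaligned_weight q \<beta> * of_bool (int q dvd n) + of_bool (\<not> int q dvd n) * ?w n" .
  show ?thesis
  proof (cases "int q dvd n")
    case True
    then have "?w n = ?w 0"
      using assms by (intro clock_weight_periodic) auto
    then show ?thesis
      unfolding * using True by (simp add: clock_weight_def algebra_simps)
  qed (simp add: *)
qed

lemma spin_weight_decomposition:
  assumes "s \<in> spin_set q" "t \<in> spin_set q"
  shows "exp (- \<beta> * (1 - cos (s - t))) = (1 - misaligned_weight q \<beta>) * of_bool (s = t)
    + (\<Sum>k<q. remainder_coeff q \<beta> k * cos (real k * (s - t)))"
proof -
  from assms obtain i j where i: "i < q" "s = 2 * pi * real i / real q"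
    and j: "j < q" "t = 2 * pi * real j / real q"
    by (auto elim!: spin_setE)
  have diff: "s - t = 2 * pi * real_of_int (int i - int j) / real q"
    by (simp add: i j diff_divide_distrib algebra_simps)
  have "int q dvd int i - int j \<longleftrightarrow> s = t"
    using i j zdvd_imp_le[of "int q" "\<bar>int i - int j\<bar>"] by (cases "i = j") auto
  moreover have "real k * (s - t) = 2 * pi * real_of_int (int i - int j) * real k / real q" for k
    by (simp add: diff)
  moreover have "exp (- \<beta> * (1 - cos (s - t))) = clock_weight q \<beta> (int i - int j)"
    by (simp add: clock_weight_def diff)
  ultimately show ?thesis
    using clock_weight_decomposition[of q \<beta> "int i - int j"] i(1) by simp
qed

lemma tendsto_misaligned_weight: "(misaligned_weight q \<longlongrightarrow> 0) at_top"
proof -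
  have "((\<lambda>\<beta>. clock_weight q \<beta> (int j)) \<longlongrightarrow> 0) at_top" if j: "j \<in> {1..<q}" for j
  proof -
    have "cos (2 * pi * real j / real q) \<noteq> 1"
    proof
      assume "cos (2 * pi * real j / real q) = 1"
      then obtain m where "2 * pi * real j / real q = real_of_int m * 2 * pi"
        using cos_one_2pi_int by auto
      then have "real_of_int (int j) = real_of_int (m * int q)"
        using j by (simp add: field_simps)
      then have "int j = m * int q"
        by (simp only: of_int_eq_iff)
      then have "int q dvd int j"
        by simp
      then show False
        using j by (auto dest: zdvd_imp_le)
    qed
    then have "1 - cos (2 * pi * real j / real q) > 0"
      using cos_le_one[of "2 * pi * real j / real q"] by linarith
    then show ?thesis
      unfolding clock_weight_def of_int_of_nat_eq
      by (intro filterlim_compose[OF exp_at_bot])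
         (simp add: filterlim_uminus_at_bot filterlim_at_top_mult_tendsto_pos[OF tendsto_const] filterlim_ident mult.commute)
  qed
  then have "((\<lambda>\<beta>. \<Sum>j\<in>{1..<q}. clock_weight q \<beta> (int j)) \<longlongrightarrow> (\<Sum>j\<in>{1..<q}. 0)) at_top"
    by (intro tendsto_sum)
  then show ?thesis
    by (simp add: misaligned_weight_def[abs_def])
qed

section \<open>Sums of cosines over configurations\<close>

text \<open>
  The character of \<open>S\<^bsup>\<Lambda>\<^esup>\<close> with frequencies \<open>m\<close> is \<open>cis (phase \<Lambda> a m \<sigma>)\<close>.  Measuring the angles from the
  boundary value \<open>a\<close> makes the spins outside \<open>\<Lambda>\<close> contribute nothing.
\<close>

definition phase :: "'v set \<Rightarrow> real \<Rightarrow> ('v \<Rightarrow> int) \<Rightarrow> ('v \<Rightarrow> real) \<Rightarrow> real" where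
  "phase \<Lambda> a m \<sigma> = (\<Sum>x\<in>\<Lambda>. real_of_int (m x) * (\<sigma> x - a))"

lemma phase_add: "phase \<Lambda> a (\<lambda>x. m x + n x) \<sigma> = phase \<Lambda> a m \<sigma> + phase \<Lambda> a n \<sigma>"
  by (simp add: phase_def sum.distrib distrib_right)

lemma phase_diff: "phase \<Lambda> a (\<lambda>x. m x - n x) \<sigma> = phase \<Lambda> a m \<sigma> - phase \<Lambda> a n \<sigma>"
  by (simp add: phase_def sum_subtractf left_diff_distrib)

lemma agreeing_configs_eq:
  "agreeing_configs q \<Lambda> \<eta> = {\<sigma>. (\<forall>x. \<sigma> x \<in> spin_set q) \<and> (\<forall>x. x \<notin> \<Lambda> \<longrightarrow> \<sigma> x = \<eta> x)}"
  by (auto simp: agreeing_configs_def config_space_def space_PiM)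

lemma sum_agreeing_configs:
  fixes f :: "(int ^ 'd::finite \<Rightarrow> real) \<Rightarrow> 'b::comm_monoid_add"
  assumes "\<And>x. \<eta> x \<in> spin_set q"
  shows "(\<Sum>\<sigma>\<in>agreeing_configs q \<Lambda> \<eta>. f \<sigma>) =
    (\<Sum>\<tau>\<in>\<Lambda> \<rightarrow>\<^sub>E spin_set q. f (\<lambda>x. if x \<in> \<Lambda> then \<tau> x else \<eta> x))"
  by (rule sum.reindex_bij_witness[of _ "\<lambda>\<tau> x. if x \<in> \<Lambda> then \<tau> x else \<eta> x" "\<lambda>\<sigma>. restrict \<sigma> \<Lambda>"])
     (use assms in \<open>auto simp: agreeing_configs_eq fun_eq_iff PiE_def extensional_def
        intro!: arg_cong[of _ _ f]\<close>)

lemma finite_agreeing_configs: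
  assumes "finite \<Lambda>"
  shows "finite (agreeing_configs q \<Lambda> \<eta>)"
proof -
  have "finite (\<Lambda> \<rightarrow>\<^sub>E spin_set q)"
    using assms by (intro finite_PiE) (auto simp: finite_spin_set)
  moreover have "agreeing_configs q \<Lambda> \<eta> \<subseteq> (\<lambda>\<tau> x. if x \<in> \<Lambda> then \<tau> x else \<eta> x) ` (\<Lambda> \<rightarrow>\<^sub>E spin_set q)"
  proof
    fix \<sigma> assume "\<sigma> \<in> agreeing_configs q \<Lambda> \<eta>"
    then show "\<sigma> \<in> (\<lambda>\<tau> x. if x \<in> \<Lambda> then \<tau> x else \<eta> x) ` (\<Lambda> \<rightarrow>\<^sub>E spin_set q)"
      by (intro image_eqI[of _ _ "restrict \<sigma> \<Lambda>"]) (auto simp: agreeing_configs_eq fun_eq_iff)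
  qed
  ultimately show ?thesis
    by (rule finite_surj)
qed

lemma sum_cis_spins:
  assumes "a \<in> spin_set q"
  shows "(\<Sum>s\<in>spin_set q. cis (real_of_int m * (s - a))) = of_real (if int q dvd m then real q else 0)"
proof -
  from assms obtain i where i: "i < q" "a = 2 * pi * real i / real q"
    by (auto elim!: spin_setE)
  have "(\<Sum>s\<in>spin_set q. cis (real_of_int m * (s - a))) =
      (\<Sum>k<q. cis (real_of_int m * (2 * pi * real k / real q - a)))"
    unfolding spin_set_def by (subst sum.reindex[OF inj_on_spin]) simp
  also have "\<dots> = (\<Sum>k<q. cis (- real_of_int m * a) * cis (2 * pi * real_of_int m * real k / real q))"
    by (intro sum.cong refl) (simp add: cis_mult algebra_simps)
  also have "\<dots> = cis (- real_of_int m * a) * (if int q dvd m then of_nat q else 0)"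
    using sum_roots_of_unity[of q m] i by (simp flip: sum_distrib_left)
  also have "\<dots> = of_real (if int q dvd m then real q else 0)"
  proof (cases "int q dvd m")
    case True
    then obtain l where "m = int q * l" ..
    then have "- real_of_int m * a = 2 * pi * real_of_int (- l * int i)"
      using i by simp
    then have "cis (- real_of_int m * a) = 1"
      by (simp only: cis_multiple_2pi Ints_of_int)
    then show ?thesis
      using True by simp
  qed simp
  finally show ?thesis .
qed

lemma cis_sum: "finite A \<Longrightarrow> cis (\<Sum>x\<in>A. f x) = (\<Prod>x\<in>A. cis (f x))"
  by (induction A rule: finite_induct) (simp_all flip: cis_mult)

text \<open>
  The complex exponential factorises over the vertices of \<open>\<Lambda>\<close>, and the sum of a character over one spin
  is \<open>q\<close> or 0.  So the result is a nonnegative multiple of \<open>cos \<phi>\<close>, and \<open>\<phi> = 0\<close> maximises it.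
\<close>

lemma sum_cos_phase:
  fixes \<Lambda> :: "(int ^ 'd::finite) set"
  assumes "finite \<Lambda>" and a: "a \<in> spin_set q"
  shows "(\<Sum>\<sigma>\<in>agreeing_configs q \<Lambda> (\<lambda>_. a). cos (phase \<Lambda> a m \<sigma> + \<phi>)) =
    (\<Prod>x\<in>\<Lambda>. if int q dvd m x then real q else 0) * cos \<phi>"
proof -
  have "(\<Sum>\<sigma>\<in>agreeing_configs q \<Lambda> (\<lambda>_. a). cis (phase \<Lambda> a m \<sigma> + \<phi>)) =
      (\<Sum>\<tau>\<in>\<Lambda> \<rightarrow>\<^sub>E spin_set q. cis \<phi> * (\<Prod>x\<in>\<Lambda>. cis (real_of_int (m x) * (\<tau> x - a))))"
    using assms by (subst sum_agreeing_configs)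
      (auto simp: phase_def cis_mult add.commute simp flip: cis_sum intro!: sum.cong)
  also have "\<dots> = cis \<phi> * (\<Prod>x\<in>\<Lambda>. \<Sum>s\<in>spin_set q. cis (real_of_int (m x) * (s - a)))"
    using assms by (subst prod_sum_PiE) (auto simp: finite_spin_set sum_distrib_left)
  also have "\<dots> = cis \<phi> * of_real (\<Prod>x\<in>\<Lambda>. if int q dvd m x then real q else 0)"
    unfolding sum_cis_spins[OF a] by simp
  finally have "Re (\<Sum>\<sigma>\<in>agreeing_configs q \<Lambda> (\<lambda>_. a). cis (phase \<Lambda> a m \<sigma> + \<phi>)) =
      Re (cis \<phi> * of_real (\<Prod>x\<in>\<Lambda>. if int q dvd m x then real q else 0))"
    by (rule arg_cong)
  then show ?thesis
    by (simp only: Re_sum cis.sel Re_complex_of_real Im_complex_of_real times_complex.sel) simp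
qed

section \<open>Functions of positive type\<close>

text \<open>
  Nonnegative combinations of cosines of phases.  Functions matter only on the configurations
  with boundary value \<open>a\<close>, where identities such as the Fourier decomposition are available, so both rules
  ask for equality only there.
\<close>

inductive positive_type :: "nat \<Rightarrow> (int ^ 'd) set \<Rightarrow> real \<Rightarrow> ((int ^ 'd \<Rightarrow> real) \<Rightarrow> real) \<Rightarrow> bool"
  for q \<Lambda> a where
  cosine: "0 \<le> c \<Longrightarrow> (\<And>\<sigma>. \<sigma> \<in> agreeing_configs q \<Lambda> (\<lambda>_. a) \<Longrightarrow> F \<sigma> = c * cos (phase \<Lambda> a m \<sigma>))
    \<Longrightarrow> positive_type q \<Lambda> a F"
| add: "positive_type q \<Lambda> a F \<Longrightarrow> positive_type q \<Lambda> a G \<Longrightarrow>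
    (\<And>\<sigma>. \<sigma> \<in> agreeing_configs q \<Lambda> (\<lambda>_. a) \<Longrightarrow> H \<sigma> = F \<sigma> + G \<sigma>) \<Longrightarrow> positive_type q \<Lambda> a H"

lemma positive_type_cong:
  assumes "positive_type q \<Lambda> a F"
    and "\<And>\<sigma>. \<sigma> \<in> agreeing_configs q \<Lambda> (\<lambda>_. a) \<Longrightarrow> G \<sigma> = F \<sigma>"
  shows "positive_type q \<Lambda> a G"
  using assms(1)
  by (rule positive_type.add[OF _ positive_type.cosine[of 0 _ _ _ "\<lambda>_. 0"]]) (auto simp: assms(2))

lemma positive_type_const: "0 \<le> c \<Longrightarrow> positive_type q \<Lambda> a (\<lambda>_. c)"
  by (rule positive_type.cosine[of c _ _ _ _ "\<lambda>_. 0"]) (auto simp: phase_def)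

lemma positive_type_add:
  "positive_type q \<Lambda> a F \<Longrightarrow> positive_type q \<Lambda> a G \<Longrightarrow> positive_type q \<Lambda> a (\<lambda>\<sigma>. F \<sigma> + G \<sigma>)"
  by (rule positive_type.add) auto

text \<open>
  \<open>2 * cos A * cos B = cos (A + B) + cos (A - B)\<close>, and sums and differences of phases are phases.
\<close>

lemma positive_type_mult:
  assumes "positive_type q \<Lambda> a F" and "positive_type q \<Lambda> a G"
  shows "positive_type q \<Lambda> a (\<lambda>\<sigma>. F \<sigma> * G \<sigma>)"
  using assms(1)
proof (induction F rule: positive_type.induct)
  case F: (cosine c F m)
  from assms(2) show ?case
  proof (induction G rule: positive_type.induct)
    case G: (cosine d G n)
    have half: "positive_type q \<Lambda> a (\<lambda>\<sigma>. c * d / 2 * cos (phase \<Lambda> a (\<lambda>x. m x - n x) \<sigma>))"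
      "positive_type q \<Lambda> a (\<lambda>\<sigma>. c * d / 2 * cos (phase \<Lambda> a (\<lambda>x. m x + n x) \<sigma>))"
      using F(1) G(1) by (intro positive_type.cosine[where c = "c * d / 2", OF _ refl]; simp)+
    show ?case
      by (rule positive_type.add[OF half])
         (simp add: F(2) G(2) phase_add phase_diff cos_add cos_diff field_simps)
  next
    case G: (add G1 G2 G)
    show ?case
      by (rule positive_type.add[OF G.IH]) (simp add: G.hyps distrib_left)
  qed
next
  case F: (add F1 F2 F)
  show ?case
    by (rule positive_type.add[OF F.IH]) (simp add: F.hyps distrib_right)
qed

lemma positive_type_sum:
  "finite I \<Longrightarrow> (\<And>i. i \<in> I \<Longrightarrow> positive_type q \<Lambda> a (F i)) \<Longrightarrow> positive_type q \<Lambda> a (\<lambda>\<sigma>. \<Sum>i\<in>I. F i \<sigma>)"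
  by (induction I rule: finite_induct) (auto intro: positive_type_add positive_type_const)

lemma positive_type_prod:
  "finite I \<Longrightarrow> (\<And>i. i \<in> I \<Longrightarrow> positive_type q \<Lambda> a (F i)) \<Longrightarrow> positive_type q \<Lambda> a (\<lambda>\<sigma>. \<Prod>i\<in>I. F i \<sigma>)"
  by (induction I rule: finite_induct) (auto intro: positive_type_mult positive_type_const)

text \<open>
  Inequalities of Griffiths type.  Both follow from the fact that the sum with an extra angle \<open>\<phi>\<close> equals
  \<open>K * cos \<phi>\<close> with a constant \<open>K \<ge> 0\<close> that does not depend on \<open>\<phi>\<close>; this property is linear, and for a single
  cosine it is \<open>sum_cos_phase\<close>.
\<close>

lemma positive_type_sum_cos_nonneg:
  fixes \<Lambda> :: "(int ^ 'd::finite) set"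
  assumes "positive_type q \<Lambda> a F" and "finite \<Lambda>" and "a \<in> spin_set q"
  shows "0 \<le> (\<Sum>\<sigma>\<in>agreeing_configs q \<Lambda> (\<lambda>_. a). F \<sigma> * cos (phase \<Lambda> a m \<sigma>))" (is "0 \<le> sum _ ?A")
    and "(\<Sum>\<sigma>\<in>agreeing_configs q \<Lambda> (\<lambda>_. a). F \<sigma> * cos (phase \<Lambda> a m \<sigma> + \<phi>))
      \<le> (\<Sum>\<sigma>\<in>agreeing_configs q \<Lambda> (\<lambda>_. a). F \<sigma> * cos (phase \<Lambda> a m \<sigma>))"
proof -
  have "\<exists>K\<ge>0. \<forall>\<phi>. (\<Sum>\<sigma>\<in>?A. F \<sigma> * cos (phase \<Lambda> a m \<sigma> + \<phi>)) = K * cos \<phi>"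
    using assms(1)
  proof (induction F rule: positive_type.induct)
    case (cosine c F n)
    let ?Q = "\<lambda>m. \<Prod>x\<in>\<Lambda>. if int q dvd m x then real q else 0"
    let ?K = "c / 2 * (?Q (\<lambda>x. m x + n x) + ?Q (\<lambda>x. m x - n x))"
    have "(\<Sum>\<sigma>\<in>?A. F \<sigma> * cos (phase \<Lambda> a m \<sigma> + \<phi>)) = ?K * cos \<phi>" for \<phi>
    proof -
      have "(\<Sum>\<sigma>\<in>?A. F \<sigma> * cos (phase \<Lambda> a m \<sigma> + \<phi>)) =
          (\<Sum>\<sigma>\<in>?A. c / 2 * cos (phase \<Lambda> a (\<lambda>x. m x + n x) \<sigma> + \<phi>)
            + c / 2 * cos (phase \<Lambda> a (\<lambda>x. m x - n x) \<sigma> + \<phi>))"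
      proof (intro sum.cong refl)
        fix \<sigma> assume "\<sigma> \<in> ?A"
        have "cos (phase \<Lambda> a (\<lambda>x. m x + n x) \<sigma> + \<phi>) + cos (phase \<Lambda> a (\<lambda>x. m x - n x) \<sigma> + \<phi>) =
            2 * cos (phase \<Lambda> a n \<sigma>) * cos (phase \<Lambda> a m \<sigma> + \<phi>)"
          by (simp add: phase_add phase_diff cos_add cos_diff sin_add sin_diff algebra_simps)
        then show "F \<sigma> * cos (phase \<Lambda> a m \<sigma> + \<phi>) = c / 2 * cos (phase \<Lambda> a (\<lambda>x. m x + n x) \<sigma> + \<phi>)
            + c / 2 * cos (phase \<Lambda> a (\<lambda>x. m x - n x) \<sigma> + \<phi>)"
          using cosine(2)[OF \<open>\<sigma> \<in> ?A\<close>]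
          by (simp only: distrib_left[symmetric])
      qed
      also have "\<dots> = ?K * cos \<phi>"
        unfolding sum.distrib sum_distrib_left[symmetric] sum_cos_phase[OF assms(2,3)]
        by (simp add: algebra_simps)
      finally show ?thesis .
    qed
    moreover have "0 \<le> ?K"
      using cosine(1) by (intro mult_nonneg_nonneg add_nonneg_nonneg prod_nonneg) auto
    ultimately show ?case
      by blast
  next
    case (add F G H)
    then obtain K L where KL: "0 \<le> K" "0 \<le> L"
      "\<And>\<phi>. (\<Sum>\<sigma>\<in>?A. F \<sigma> * cos (phase \<Lambda> a m \<sigma> + \<phi>)) = K * cos \<phi>"
      "\<And>\<phi>. (\<Sum>\<sigma>\<in>?A. G \<sigma> * cos (phase \<Lambda> a m \<sigma> + \<phi>)) = L * cos \<phi>"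
      by blast
    have "(\<Sum>\<sigma>\<in>?A. H \<sigma> * cos (phase \<Lambda> a m \<sigma> + \<phi>)) = (K + L) * cos \<phi>" for \<phi>
      using KL by (simp add: add.hyps distrib_right sum.distrib cong: sum.cong)
    with KL show ?case
      by (intro exI[of _ "K + L"]) auto
  qed
  then obtain K where K: "0 \<le> K" "\<And>\<phi>. (\<Sum>\<sigma>\<in>?A. F \<sigma> * cos (phase \<Lambda> a m \<sigma> + \<phi>)) = K * cos \<phi>"
    by blast
  have K0: "(\<Sum>\<sigma>\<in>?A. F \<sigma> * cos (phase \<Lambda> a m \<sigma>)) = K"
    using K(2)[of 0] by simp
  show "0 \<le> (\<Sum>\<sigma>\<in>?A. F \<sigma> * cos (phase \<Lambda> a m \<sigma>))"
    using K(1) K0 by simp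
  show "(\<Sum>\<sigma>\<in>?A. F \<sigma> * cos (phase \<Lambda> a m \<sigma> + \<phi>)) \<le> (\<Sum>\<sigma>\<in>?A. F \<sigma> * cos (phase \<Lambda> a m \<sigma>))"
    unfolding K0 K(2) using K(1) mult_left_mono[OF cos_le_one, of K \<phi>] by simp
qed

lemma positive_type_sum_nonneg:
  fixes \<Lambda> :: "(int ^ 'd::finite) set"
  assumes "positive_type q \<Lambda> a F" and "finite \<Lambda>" and "a \<in> spin_set q"
  shows "0 \<le> (\<Sum>\<sigma>\<in>agreeing_configs q \<Lambda> (\<lambda>_. a). F \<sigma>)"
  using positive_type_sum_cos_nonneg(1)[OF assms, of "\<lambda>_. 0"] by (simp add: phase_def)

lemma phase_single:
  assumes "finite \<Lambda>" "\<sigma> \<in> agreeing_configs q \<Lambda> (\<lambda>_. a)"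
  shows "phase \<Lambda> a (\<lambda>x. k * of_bool (x = u)) \<sigma> = real_of_int k * (\<sigma> u - a)"
proof -
  have "phase \<Lambda> a (\<lambda>x. k * of_bool (x = u)) \<sigma> = (\<Sum>x\<in>\<Lambda>. if x = u then real_of_int k * (\<sigma> x - a) else 0)"
    unfolding phase_def by (intro sum.cong) auto
  also have "\<dots> = (if u \<in> \<Lambda> then real_of_int k * (\<sigma> u - a) else 0)"
    using assms(1) by (rule sum.delta)
  also have "\<dots> = real_of_int k * (\<sigma> u - a)"
    using assms(2) by (auto simp: agreeing_configs_eq)
  finally show ?thesis .
qed

lemma phase_pair:
  assumes "finite \<Lambda>" "\<sigma> \<in> agreeing_configs q \<Lambda> (\<lambda>_. a)"
  shows "phase \<Lambda> a (\<lambda>x. int k * of_bool (x = u) - int k * of_bool (x = v)) \<sigma> = real k * (\<sigma> u - \<sigma> v)"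
  using assms by (simp only: phase_diff phase_single) (simp add: algebra_simps)

lemma positive_type_cos_difference:
  assumes "finite \<Lambda>"
  shows "positive_type q \<Lambda> a (\<lambda>\<sigma>. cos (real k * (\<sigma> u - \<sigma> v)))"
  by (rule positive_type.cosine[of 1 _ _ _ _ "\<lambda>x. int k * of_bool (x = u) - int k * of_bool (x = v)"])
     (use assms in \<open>simp_all add: phase_pair\<close>)

lemma agreeing_configs_spin: "\<sigma> \<in> agreeing_configs q \<Lambda> \<eta> \<Longrightarrow> \<sigma> x \<in> spin_set q"
  by (simp add: agreeing_configs_eq)

section \<open>Expansion of the edge weights\<close>

definition constant_on_edge :: "'v set \<Rightarrow> ('v \<Rightarrow> real) \<Rightarrow> bool" where
  "constant_on_edge e \<sigma> \<longleftrightarrow> (\<forall>u\<in>e. \<forall>v\<in>e. \<sigma> u = \<sigma> v)"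

lemma constant_on_edge_eq:
  assumes "q > 0" "\<sigma> \<in> agreeing_configs q \<Lambda> \<eta>"
  shows "of_bool (constant_on_edge {u, v} \<sigma>) = (\<Sum>k<q. 1 / real q * cos (real k * (\<sigma> u - \<sigma> v)))"
proof -
  have "constant_on_edge {u, v} \<sigma> \<longleftrightarrow> \<sigma> u = \<sigma> v"
    by (auto simp: constant_on_edge_def)
  moreover have "(\<Sum>k<q. 1 / real q * cos (real k * (\<sigma> u - \<sigma> v))) = of_bool (\<sigma> u = \<sigma> v)"
    using sum_cos_spin_difference[of "\<sigma> u" q "\<sigma> v"] agreeing_configs_spin[OF assms(2)] assms(1)
    by (simp flip: sum_divide_distrib)
  ultimately show ?thesis
    by simp
qed

definition edge_remainder :: "nat \<Rightarrow> real \<Rightarrow> 'v set \<Rightarrow> ('v \<Rightarrow> real) \<Rightarrow> real" where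
  "edge_remainder q \<beta> e \<sigma> =
    exp (- \<beta> * bond_energy \<sigma> e) - (1 - misaligned_weight q \<beta>) * of_bool (constant_on_edge e \<sigma>)"

lemma edge_remainder_eq:
  assumes "\<sigma> \<in> agreeing_configs q \<Lambda> \<eta>"
  shows "edge_remainder q \<beta> {u, v} \<sigma> = (\<Sum>k<q. remainder_coeff q \<beta> k * cos (real k * (\<sigma> u - \<sigma> v)))"
proof -
  have "constant_on_edge {u, v} \<sigma> \<longleftrightarrow> \<sigma> u = \<sigma> v"
    by (auto simp: constant_on_edge_def)
  then show ?thesis
    using spin_weight_decomposition[of "\<sigma> u" q "\<sigma> v" \<beta>] agreeing_configs_spin[OF assms]
    by (simp add: edge_remainder_def bond_energy_pair)
qed

lemma positive_type_constant_on_edge: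
  assumes "finite \<Lambda>" "q > 0"
  shows "positive_type q \<Lambda> a (\<lambda>\<sigma>. of_bool (constant_on_edge {u, v} \<sigma>))"
proof (rule positive_type_cong[OF _ constant_on_edge_eq])
  show "positive_type q \<Lambda> a (\<lambda>\<sigma>. \<Sum>k<q. 1 / real q * cos (real k * (\<sigma> u - \<sigma> v)))"
    using assms(1) by (intro positive_type_sum positive_type_mult
      positive_type_const positive_type_cos_difference) simp_all
qed (use assms in auto)

lemma positive_type_edge_remainder:
  assumes "finite \<Lambda>"
  shows "positive_type q \<Lambda> a (edge_remainder q \<beta> {u, v})"
  using assms
  by (intro positive_type_cong[OF _ edge_remainder_eq] positive_type_sum positive_type_mult
      positive_type_const positive_type_cos_difference remainder_coeff_nonneg) auto

lemma edge_weight_split: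
  "exp (- \<beta> * bond_energy \<sigma> e) =
    (1 - misaligned_weight q \<beta>) * of_bool (constant_on_edge e \<sigma>) + edge_remainder q \<beta> e \<sigma>"
  by (simp add: edge_remainder_def)

lemma positive_type_edge_weight:
  assumes "finite \<Lambda>" "q > 0" "misaligned_weight q \<beta> \<le> 1"
  shows "positive_type q \<Lambda> a (\<lambda>\<sigma>. exp (- \<beta> * bond_energy \<sigma> {u, v}))"
  unfolding edge_weight_split[of \<beta> _ _ q] using assms
  by (intro positive_type_add positive_type_mult positive_type_const positive_type_constant_on_edge
      positive_type_edge_remainder) auto

text \<open>
  The finite-energy estimate.  Both functions of the edge are combinations of the cosines of
  \<open>k * (\<sigma> u - \<sigma> v)\<close>, whose sums against \<open>F\<close> are nonnegative, so it suffices to compare coefficients: they are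
  at most \<open>2 * \<epsilon> / q\<close> for the remainder and equal to \<open>1 / q\<close> for the indicator.
\<close>

lemma sum_edge_remainder_le:
  fixes \<Lambda> :: "(int ^ 'd::finite) set"
  assumes F: "positive_type q \<Lambda> a F" and \<Lambda>: "finite \<Lambda>" and a: "a \<in> spin_set q"
  shows "(\<Sum>\<sigma>\<in>agreeing_configs q \<Lambda> (\<lambda>_. a). F \<sigma> * edge_remainder q \<beta> {u, v} \<sigma>)
    \<le> 2 * misaligned_weight q \<beta> *
      (\<Sum>\<sigma>\<in>agreeing_configs q \<Lambda> (\<lambda>_. a). F \<sigma> * of_bool (constant_on_edge {u, v} \<sigma>))"
proof -
  let ?A = "agreeing_configs q \<Lambda> (\<lambda>_. a)"
  let ?c = "\<lambda>k \<sigma>. cos (real k * (\<sigma> u - \<sigma> v))"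
  have q: "q > 0"
    using a by (auto simp: spin_set_def)
  have swap: "(\<Sum>\<sigma>\<in>?A. F \<sigma> * (\<Sum>k<q. \<rho> k * ?c k \<sigma>)) = (\<Sum>k<q. \<rho> k * (\<Sum>\<sigma>\<in>?A. F \<sigma> * ?c k \<sigma>))" for \<rho> :: "nat \<Rightarrow> real"
    unfolding sum_distrib_left by (subst sum.swap) (simp add: mult_ac)
  have nonneg: "0 \<le> (\<Sum>\<sigma>\<in>?A. F \<sigma> * ?c k \<sigma>)" for k
    using positive_type_sum_nonneg[OF positive_type_mult[OF F positive_type_cos_difference[OF \<Lambda>]] \<Lambda> a] .
  have "(\<Sum>\<sigma>\<in>?A. F \<sigma> * edge_remainder q \<beta> {u, v} \<sigma>) =
      (\<Sum>k<q. remainder_coeff q \<beta> k * (\<Sum>\<sigma>\<in>?A. F \<sigma> * ?c k \<sigma>))"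
    unfolding swap[symmetric] by (intro sum.cong refl) (simp add: edge_remainder_eq)
  also have "\<dots> \<le> (\<Sum>k<q. 2 * misaligned_weight q \<beta> / real q * (\<Sum>\<sigma>\<in>?A. F \<sigma> * ?c k \<sigma>))"
    by (intro sum_mono mult_right_mono remainder_coeff_le nonneg)
  also have "\<dots> = 2 * misaligned_weight q \<beta> * (\<Sum>k<q. 1 / real q * (\<Sum>\<sigma>\<in>?A. F \<sigma> * ?c k \<sigma>))"
    by (simp add: sum_distrib_left)
  also have "(\<Sum>k<q. 1 / real q * (\<Sum>\<sigma>\<in>?A. F \<sigma> * ?c k \<sigma>)) =
      (\<Sum>\<sigma>\<in>?A. F \<sigma> * of_bool (constant_on_edge {u, v} \<sigma>))"
    unfolding swap[symmetric] using q by (intro sum.cong refl) (simp add: constant_on_edge_eq)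
  finally show ?thesis .
qed

definition spin_bias :: "'v \<Rightarrow> real \<Rightarrow> real \<Rightarrow> ('v \<Rightarrow> real) \<Rightarrow> real" where
  "spin_bias x a b \<sigma> = of_bool (\<sigma> x = a) - of_bool (\<sigma> x = b)"

text \<open>
  The indicators of \<open>\<sigma> x = a\<close> and \<open>\<sigma> x = b\<close> are averages of cosines of the same phases, the second one
  with the additional angle \<open>k * (a - b)\<close>, which can only lower the sum against \<open>F\<close>.
\<close>

lemma sum_spin_bias_nonneg:
  fixes \<Lambda> :: "(int ^ 'd::finite) set"
  assumes F: "positive_type q \<Lambda> a F" and \<Lambda>: "finite \<Lambda>" and a: "a \<in> spin_set q" and b: "b \<in> spin_set q"
  shows "0 \<le> (\<Sum>\<sigma>\<in>agreeing_configs q \<Lambda> (\<lambda>_. a). F \<sigma> * spin_bias x a b \<sigma>)"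
proof -
  let ?A = "agreeing_configs q \<Lambda> (\<lambda>_. a)"
  let ?m = "\<lambda>k y. int k * of_bool (y = x)"
  have q: "q > 0"
    using a by (auto simp: spin_set_def)
  have "spin_bias x a b \<sigma> =
      (\<Sum>k<q. (cos (phase \<Lambda> a (?m k) \<sigma>) - cos (phase \<Lambda> a (?m k) \<sigma> + real k * (a - b)))) / real q"
    if \<sigma>: "\<sigma> \<in> ?A" for \<sigma>
  proof -
    have "cos (phase \<Lambda> a (?m k) \<sigma> + real k * (a - b)) = cos (real k * (\<sigma> x - b))"
      "cos (phase \<Lambda> a (?m k) \<sigma>) = cos (real k * (\<sigma> x - a))" for k
      by (simp_all add: phase_single[OF \<Lambda> \<sigma>] algebra_simps)
    then show ?thesis
      using sum_cos_spin_difference[OF agreeing_configs_spin[OF \<sigma>] a, of x]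
        sum_cos_spin_difference[OF agreeing_configs_spin[OF \<sigma>] b, of x] q
      by (simp add: spin_bias_def sum_subtractf diff_divide_distrib)
  qed
  then have "(\<Sum>\<sigma>\<in>?A. F \<sigma> * spin_bias x a b \<sigma>) =
      (\<Sum>\<sigma>\<in>?A. \<Sum>k<q. F \<sigma> * (cos (phase \<Lambda> a (?m k) \<sigma>) - cos (phase \<Lambda> a (?m k) \<sigma> + real k * (a - b)))) / real q"
    by (simp add: sum_distrib_left sum_divide_distrib)
  also have "\<dots> = (\<Sum>k<q. (\<Sum>\<sigma>\<in>?A. F \<sigma> * cos (phase \<Lambda> a (?m k) \<sigma>))
      - (\<Sum>\<sigma>\<in>?A. F \<sigma> * cos (phase \<Lambda> a (?m k) \<sigma> + real k * (a - b)))) / real q"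
    by (subst sum.swap) (simp add: right_diff_distrib sum_subtractf)
  also have "\<dots> \<ge> 0"
    using positive_type_sum_cos_nonneg(2)[OF F \<Lambda> a]
    by (intro divide_nonneg_nonneg sum_nonneg) simp_all
  finally show ?thesis .
qed

lemma escapes_imp_boundary_spin:
  assumes "escapes \<Lambda> x D" and "\<And>e. e \<in> D \<Longrightarrow> constant_on_edge e \<sigma>"
    and "\<And>y. y \<notin> \<Lambda> \<Longrightarrow> \<sigma> y = a"
  shows "\<sigma> x = a"
proof -
  from assms(1) obtain y where y: "y \<notin> \<Lambda>" "(x, y) \<in> {(u, v). {u, v} \<in> D}\<^sup>*"
    by (auto simp: escapes_def)
  from y(2) have "\<sigma> x = \<sigma> y"
  proof (induction rule: rtrancl_induct)
    case (step y z)
    then have "constant_on_edge {y, z} \<sigma>"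
      using assms(2) by simp
    then have "\<sigma> y = \<sigma> z"
      unfolding constant_on_edge_def by blast
    with step.IH show ?case
      by simp
  qed simp
  with y(1) assms(3) show ?thesis
    by simp
qed

text \<open>
  The heart of the proof.  The edges in \<open>U\<close> carry the full weight, those in \<open>D\<close> have already been forced to be
  aligned (this constraint is part of \<open>F\<close>), and the remainders of the other treated edges are factors of
  \<open>F\<close>.  Without untreated edges the bias is total if \<open>D\<close> joins \<open>x\<close> to the boundary, and nonnegative
  otherwise.  Splitting the weight of an edge \<open>e\<close> gives a mixture of the aligned case, of partition sum
  \<open>(1 - \<epsilon>) * Z1\<close>, and the remainder case, of partition sum \<open>Z0\<close>.  The finite-energy estimate \<open>Z0 \<le> 2 * \<epsilon> * Z1\<close>
  shows that the aligned case has probability at least \<open>r\<close>.  Percolation supplies the comparison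
  \<open>B0 \<le> B1\<close> between the two lower bounds; for the biases themselves no such comparison is available.
\<close>

lemma spin_bias_ge_bernoulli_sum:
  fixes \<Lambda> :: "(int ^ 'd::finite) set"
  assumes \<Lambda>: "finite \<Lambda>" and a: "a \<in> spin_set q" and b: "b \<in> spin_set q" "b \<noteq> a"
    and cost: "misaligned_weight q \<beta> \<le> 1" and r: "r \<in> {0..1}"
    and r_cost: "r * (2 * misaligned_weight q \<beta>) \<le> (1 - r) * (1 - misaligned_weight q \<beta>)"
    and U: "finite U" "\<And>e. e \<in> U \<Longrightarrow> \<exists>u v. e = {u, v}"
    and F: "positive_type q \<Lambda> a F"
    and D: "\<And>\<sigma> e. \<sigma> \<in> agreeing_configs q \<Lambda> (\<lambda>_. a) \<Longrightarrow> F \<sigma> \<noteq> 0 \<Longrightarrow> e \<in> D \<Longrightarrow> constant_on_edge e \<sigma>"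
  defines "w \<equiv> \<lambda>U \<sigma>. \<Prod>e\<in>U. exp (- \<beta> * bond_energy \<sigma> e)"
  shows "bernoulli_sum r U (\<lambda>\<xi>. escapes \<Lambda> x (D \<union> \<xi>)) * (\<Sum>\<sigma>\<in>agreeing_configs q \<Lambda> (\<lambda>_. a). F \<sigma> * w U \<sigma>)
    \<le> (\<Sum>\<sigma>\<in>agreeing_configs q \<Lambda> (\<lambda>_. a). F \<sigma> * w U \<sigma> * spin_bias x a b \<sigma>)"
  using U F D
proof (induction U arbitrary: F D rule: finite_induct)
  case empty
  let ?A = "agreeing_configs q \<Lambda> (\<lambda>_. a)"
  show ?case
  proof (cases "escapes \<Lambda> x D")
    case True
    have "F \<sigma> * spin_bias x a b \<sigma> = F \<sigma>" if \<sigma>: "\<sigma> \<in> ?A" for \<sigma>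
    proof (cases "F \<sigma> = 0")
      case False
      have "\<sigma> x = a"
      proof (rule escapes_imp_boundary_spin[OF True])
        show "constant_on_edge e \<sigma>" if "e \<in> D" for e
          using empty.prems(3)[OF \<sigma> False that] .
        show "\<sigma> y = a" if "y \<notin> \<Lambda>" for y
          using \<sigma> that by (simp add: agreeing_configs_eq)
      qed
      with b show ?thesis
        by (simp add: spin_bias_def)
    qed simp
    then have "(\<Sum>\<sigma>\<in>?A. F \<sigma> * spin_bias x a b \<sigma>) = (\<Sum>\<sigma>\<in>?A. F \<sigma>)"
      by (rule sum.cong[OF refl])
    with True show ?thesis
      by (simp add: bernoulli_sum_empty w_def)
  next
    case False
    then show ?thesis
      using sum_spin_bias_nonneg[OF empty.prems(2) \<Lambda> a b(1)] by (simp add: bernoulli_sum_empty w_def)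
  qed
next
  case (insert e U)
  let ?A = "agreeing_configs q \<Lambda> (\<lambda>_. a)"
  let ?\<epsilon> = "misaligned_weight q \<beta>"
  have q: "q > 0"
    using a by (auto simp: spin_set_def)
  obtain u v where e: "e = {u, v}"
    using insert.prems(1) by blast
  have U_pairs: "\<exists>u v. e = {u, v}" if "e \<in> U" for e
    using insert.prems(1) that by blast
  define F1 where "F1 \<sigma> = F \<sigma> * of_bool (constant_on_edge e \<sigma>)" for \<sigma>
  define F0 where "F0 \<sigma> = F \<sigma> * edge_remainder q \<beta> e \<sigma>" for \<sigma>
  have F1: "positive_type q \<Lambda> a F1"
    unfolding F1_def e by (intro positive_type_mult insert.prems(2) positive_type_constant_on_edge \<Lambda> q)
  have F0: "positive_type q \<Lambda> a F0"
    unfolding F0_def e by (intro positive_type_mult insert.prems(2) positive_type_edge_remainder \<Lambda>)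
  define B1 where "B1 = bernoulli_sum r U (\<lambda>\<xi>. escapes \<Lambda> x (insert e D \<union> \<xi>))"
  define B0 where "B0 = bernoulli_sum r U (\<lambda>\<xi>. escapes \<Lambda> x (D \<union> \<xi>))"
  define Z1 where "Z1 = (\<Sum>\<sigma>\<in>?A. F1 \<sigma> * w U \<sigma>)"
  define Z0 where "Z0 = (\<Sum>\<sigma>\<in>?A. F0 \<sigma> * w U \<sigma>)"
  have IH1: "B1 * Z1 \<le> (\<Sum>\<sigma>\<in>?A. F1 \<sigma> * w U \<sigma> * spin_bias x a b \<sigma>)"
    unfolding B1_def Z1_def using insert.prems(3)
    by (intro insert.IH[OF U_pairs F1]) (auto simp: F1_def)
  have IH0: "B0 * Z0 \<le> (\<Sum>\<sigma>\<in>?A. F0 \<sigma> * w U \<sigma> * spin_bias x a b \<sigma>)"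
    unfolding B0_def Z0_def using insert.prems(3)
    by (intro insert.IH[OF U_pairs F0]) (auto simp: F0_def)
  have split: "F \<sigma> * w (insert e U) \<sigma> = (1 - ?\<epsilon>) * (F1 \<sigma> * w U \<sigma>) + F0 \<sigma> * w U \<sigma>" for \<sigma>
    unfolding w_def prod.insert[OF insert.hyps] edge_weight_split[of \<beta> \<sigma> e q] F1_def F0_def
    by (simp add: algebra_simps)
  have B: "bernoulli_sum r (insert e U) (\<lambda>\<xi>. escapes \<Lambda> x (D \<union> \<xi>)) = r * B1 + (1 - r) * B0"
    unfolding bernoulli_sum_insert[OF insert.hyps] B1_def B0_def by simp
  have B01: "B0 \<le> B1"
    unfolding B0_def B1_def using r by (intro bernoulli_sum_mono) (auto elim: escapes_mono)
  have "positive_type q \<Lambda> a (\<lambda>\<sigma>. F \<sigma> * w U \<sigma>)"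
    unfolding w_def
  proof (intro positive_type_mult insert.prems(2) positive_type_prod insert.hyps)
    fix f assume "f \<in> U"
    then show "positive_type q \<Lambda> a (\<lambda>\<sigma>. exp (- \<beta> * bond_energy \<sigma> f))"
      using U_pairs positive_type_edge_weight[OF \<Lambda> q cost] by metis
  qed
  from sum_edge_remainder_le[OF this \<Lambda> a, of \<beta> u v] have Z01: "Z0 \<le> 2 * ?\<epsilon> * Z1"
    by (simp add: Z0_def Z1_def F0_def F1_def e mult_ac)
  have Z1: "0 \<le> Z1"
    unfolding Z1_def
  proof (rule positive_type_sum_nonneg[OF positive_type_mult[OF F1] \<Lambda> a])
    show "positive_type q \<Lambda> a (w U)"
      unfolding w_def
    proof (intro positive_type_prod insert.hyps)
      fix f assume "f \<in> U"
      then show "positive_type q \<Lambda> a (\<lambda>\<sigma>. exp (- \<beta> * bond_energy \<sigma> f))"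
        using U_pairs positive_type_edge_weight[OF \<Lambda> q cost] by metis
    qed
  qed
  \<comment> \<open>The claim reduces to \<open>(B1 - B0) * (r * Z0) \<le> (B1 - B0) * ((1 - r) * (1 - \<epsilon>) * Z1)\<close>.\<close>
  have "r * Z0 \<le> r * (2 * ?\<epsilon> * Z1)"
    using r Z01 by (intro mult_left_mono) auto
  also have "\<dots> \<le> (1 - r) * (1 - ?\<epsilon>) * Z1"
    using mult_right_mono[OF r_cost Z1] by (simp add: mult_ac)
  finally have "(B1 - B0) * (r * Z0) \<le> (B1 - B0) * ((1 - r) * (1 - ?\<epsilon>) * Z1)"
    using B01 by (intro mult_left_mono) auto
  then have "(r * B1 + (1 - r) * B0) * ((1 - ?\<epsilon>) * Z1 + Z0) \<le> (1 - ?\<epsilon>) * (B1 * Z1) + B0 * Z0"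
    by (simp add: algebra_simps)
  also have "\<dots> \<le> (1 - ?\<epsilon>) * (\<Sum>\<sigma>\<in>?A. F1 \<sigma> * w U \<sigma> * spin_bias x a b \<sigma>)
      + (\<Sum>\<sigma>\<in>?A. F0 \<sigma> * w U \<sigma> * spin_bias x a b \<sigma>)"
    using IH1 IH0 cost by (intro add_mono mult_left_mono) auto
  also have "\<dots> = (\<Sum>\<sigma>\<in>?A. F \<sigma> * w (insert e U) \<sigma> * spin_bias x a b \<sigma>)"
    unfolding split by (simp add: distrib_right sum.distrib sum_distrib_left mult.assoc)
  also have "(1 - ?\<epsilon>) * Z1 + Z0 = (\<Sum>\<sigma>\<in>?A. F \<sigma> * w (insert e U) \<sigma>)"
    unfolding split Z1_def Z0_def by (simp add: sum.distrib sum_distrib_left)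
  finally show ?case
    unfolding B .
qed

section \<open>Sequential compactness of measures on configurations\<close>

definition spin_cylinder :: "nat \<Rightarrow> (int ^ 'd) set \<Rightarrow> (int ^ 'd \<Rightarrow> real) \<Rightarrow> (int ^ 'd \<Rightarrow> real) set" where
  "spin_cylinder q \<Delta> \<xi> = {\<sigma> \<in> space (config_space q). \<forall>x\<in>\<Delta>. \<sigma> x = \<xi> x}"

lemma space_config_space: "space (config_space q) = {\<sigma>. \<forall>x. \<sigma> x \<in> spin_set q}"
  by (auto simp: config_space_def space_PiM)

lemma spin_cylinder_in_sets:
  assumes "finite \<Delta>"
  shows "spin_cylinder q \<Delta> \<xi> \<in> sets (config_space q)"
  unfolding spin_cylinder_def
proof (rule sets.sets_Collect_finite_All)
  fix x
  have "{\<sigma> \<in> space (config_space q). \<sigma> x = \<xi> x} = {\<sigma> \<in> space (config_space q). \<sigma> x \<in> {\<xi> x} \<inter> spin_set q}"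
    by (auto simp: space_config_space)
  also have "\<dots> \<in> sets (config_space q)"
    unfolding config_space_def by (rule sets_Collect_single') auto
  finally show "{\<sigma> \<in> space (config_space q). \<sigma> x = \<xi> x} \<in> sets (config_space q)" .
qed fact

lemma spin_cylinder_restrict:
  assumes "\<sigma> \<in> space (config_space q)" "\<xi> \<in> \<Delta> \<rightarrow>\<^sub>E spin_set q"
  shows "\<sigma> \<in> spin_cylinder q \<Delta> \<xi> \<longleftrightarrow> restrict \<sigma> \<Delta> = \<xi>"
  using assms by (auto simp: spin_cylinder_def fun_eq_iff PiE_def extensional_def restrict_def)

lemma zero_in_spin_set: "q > 0 \<Longrightarrow> 0 \<in> spin_set q"
  by (auto simp: spin_set_def intro: image_eqI[of _ _ 0])

definition depends_on :: "nat \<Rightarrow> (int ^ 'd) set \<Rightarrow> ((int ^ 'd \<Rightarrow> real) \<Rightarrow> 'b) \<Rightarrow> bool" where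
  "depends_on q \<Delta> f \<longleftrightarrow> (\<forall>\<sigma> \<in> space (config_space q). \<forall>\<tau> \<in> space (config_space q).
     (\<forall>x \<in> \<Delta>. \<sigma> x = \<tau> x) \<longrightarrow> f \<sigma> = f \<tau>)"

lemma local_function_iff: "local_function q f \<longleftrightarrow> (\<exists>\<Delta>. finite \<Delta> \<and> depends_on q \<Delta> f)"
  by (simp add: local_function_def depends_on_def)

text \<open>
  The default 0 is a spin (for \<open>q > 0\<close>), so the extension of a local configuration is a configuration.
\<close>

definition extend_zero :: "(int ^ 'd) set \<Rightarrow> (int ^ 'd \<Rightarrow> real) \<Rightarrow> int ^ 'd \<Rightarrow> real" where
  "extend_zero \<Delta> \<xi> x = (if x \<in> \<Delta> then \<xi> x else 0)"

lemma depends_on_eq_sum: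
  fixes f :: "(int ^ 'd::finite \<Rightarrow> real) \<Rightarrow> real"
  assumes q: "q > 0" and \<Delta>: "finite \<Delta>" "depends_on q \<Delta> f" and \<sigma>: "\<sigma> \<in> space (config_space q)"
  shows "f \<sigma> = (\<Sum>\<xi>\<in>\<Delta> \<rightarrow>\<^sub>E spin_set q. f (extend_zero \<Delta> \<xi>) * indicator (spin_cylinder q \<Delta> \<xi>) \<sigma>)"
proof -
  have r: "restrict \<sigma> \<Delta> \<in> \<Delta> \<rightarrow>\<^sub>E spin_set q"
    using \<sigma> by (auto simp: space_config_space)
  have "(\<Sum>\<xi>\<in>\<Delta> \<rightarrow>\<^sub>E spin_set q. f (extend_zero \<Delta> \<xi>) * indicator (spin_cylinder q \<Delta> \<xi>) \<sigma>) =
      (\<Sum>\<xi>\<in>\<Delta> \<rightarrow>\<^sub>E spin_set q. if restrict \<sigma> \<Delta> = \<xi> then f (extend_zero \<Delta> \<xi>) else 0)"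
    using spin_cylinder_restrict[OF \<sigma>] by (intro sum.cong) (auto simp: indicator_def)
  also have "\<dots> = f (extend_zero \<Delta> (restrict \<sigma> \<Delta>))"
    using r \<Delta>(1) by (subst sum.delta') (auto intro!: finite_PiE finite_spin_set)
  also have "\<dots> = f \<sigma>"
  proof -
    have "extend_zero \<Delta> (restrict \<sigma> \<Delta>) \<in> space (config_space q)"
      using \<sigma> zero_in_spin_set[OF q] by (simp add: space_config_space extend_zero_def)
    then show ?thesis
      by (rule \<Delta>(2)[unfolded depends_on_def, rule_format, OF _ \<sigma>]) (simp add: extend_zero_def)
  qed
  finally show ?thesis ..
qed

lemma depends_on_measurable:
  fixes f :: "(int ^ 'd::finite \<Rightarrow> real) \<Rightarrow> real"
  assumes q: "q > 0" and \<Delta>: "finite \<Delta>" "depends_on q \<Delta> f"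
  shows "f \<in> borel_measurable (config_space q)"
proof -
  have "(\<lambda>\<sigma>. \<Sum>\<xi>\<in>\<Delta> \<rightarrow>\<^sub>E spin_set q. f (extend_zero \<Delta> \<xi>) * indicator (spin_cylinder q \<Delta> \<xi>) \<sigma> :: real)
      \<in> borel_measurable (config_space q)"
    using spin_cylinder_in_sets[OF \<Delta>(1)]
    by (intro borel_measurable_sum borel_measurable_times borel_measurable_indicator) auto
  then show ?thesis
    by (subst measurable_cong[OF depends_on_eq_sum[OF assms]]) auto
qed

lemma integral_depends_on:
  fixes f :: "(int ^ 'd::finite \<Rightarrow> real) \<Rightarrow> real"
  assumes q: "q > 0" and \<Delta>: "finite \<Delta>" "depends_on q \<Delta> f"
    and \<mu>: "prob_space \<mu>" "sets \<mu> = sets (config_space q)"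
  shows "(\<integral>\<sigma>. f \<sigma> \<partial>\<mu>) =
    (\<Sum>\<xi>\<in>\<Delta> \<rightarrow>\<^sub>E spin_set q. f (extend_zero \<Delta> \<xi>) * measure \<mu> (spin_cylinder q \<Delta> \<xi>))"
proof -
  interpret prob_space \<mu> by fact
  have sp: "space \<mu> = space (config_space q)"
    using \<mu>(2) by (rule sets_eq_imp_space_eq)
  have cyl: "spin_cylinder q \<Delta> \<xi> \<in> sets \<mu>" for \<xi>
    using spin_cylinder_in_sets[OF \<Delta>(1)] \<mu>(2) by simp
  have "(\<integral>\<sigma>. f \<sigma> \<partial>\<mu>) =
      (\<integral>\<sigma>. (\<Sum>\<xi>\<in>\<Delta> \<rightarrow>\<^sub>E spin_set q. f (extend_zero \<Delta> \<xi>) * indicator (spin_cylinder q \<Delta> \<xi>) \<sigma>) \<partial>\<mu>)"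
    by (intro Bochner_Integration.integral_cong refl depends_on_eq_sum q \<Delta>) (simp add: sp)
  also have "\<dots> = (\<Sum>\<xi>\<in>\<Delta> \<rightarrow>\<^sub>E spin_set q.
      (\<integral>\<sigma>. f (extend_zero \<Delta> \<xi>) * indicator (spin_cylinder q \<Delta> \<xi>) \<sigma> \<partial>\<mu>))"
    using cyl by (intro Bochner_Integration.integral_sum)
      (auto intro!: integrable_real_indicator simp: emeasure_eq_measure)
  also have "\<dots> = (\<Sum>\<xi>\<in>\<Delta> \<rightarrow>\<^sub>E spin_set q. f (extend_zero \<Delta> \<xi>) * measure \<mu> (spin_cylinder q \<Delta> \<xi>))"
    using cyl by simp
  finally show ?thesis .
qed

lemma measure_restrict_eq_sum:
  assumes \<Delta>: "finite \<Delta>" and \<mu>: "prob_space \<mu>" "sets \<mu> = sets (config_space q)"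
  shows "measure \<mu> {\<sigma> \<in> space (config_space q). restrict \<sigma> \<Delta> \<in> B} =
    (\<Sum>\<xi>\<in>(\<Delta> \<rightarrow>\<^sub>E spin_set q) \<inter> B. measure \<mu> (spin_cylinder q \<Delta> \<xi>))"
proof -
  interpret prob_space \<mu> by fact
  have "{\<sigma> \<in> space (config_space q). restrict \<sigma> \<Delta> \<in> B} =
      (\<Union>\<xi>\<in>(\<Delta> \<rightarrow>\<^sub>E spin_set q) \<inter> B. spin_cylinder q \<Delta> \<xi>)"
  proof (intro set_eqI iffI)
    fix \<sigma> assume \<sigma>: "\<sigma> \<in> {\<sigma> \<in> space (config_space q). restrict \<sigma> \<Delta> \<in> B}"
    then have r: "restrict \<sigma> \<Delta> \<in> (\<Delta> \<rightarrow>\<^sub>E spin_set q) \<inter> B"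
      by (auto simp: space_config_space)
    then show "\<sigma> \<in> (\<Union>\<xi>\<in>(\<Delta> \<rightarrow>\<^sub>E spin_set q) \<inter> B. spin_cylinder q \<Delta> \<xi>)"
      using \<sigma> by (intro UN_I[OF r]) (auto simp: spin_cylinder_def)
  next
    fix \<sigma> assume "\<sigma> \<in> (\<Union>\<xi>\<in>(\<Delta> \<rightarrow>\<^sub>E spin_set q) \<inter> B. spin_cylinder q \<Delta> \<xi>)"
    then obtain \<xi> where \<xi>: "\<xi> \<in> \<Delta> \<rightarrow>\<^sub>E spin_set q" "\<xi> \<in> B" "\<sigma> \<in> spin_cylinder q \<Delta> \<xi>"
      by blast
    moreover from this have "\<sigma> \<in> space (config_space q)"
      by (simp add: spin_cylinder_def)
    ultimately show "\<sigma> \<in> {\<sigma> \<in> space (config_space q). restrict \<sigma> \<Delta> \<in> B}"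
      using spin_cylinder_restrict[of \<sigma> q \<xi> \<Delta>] by simp
  qed
  also have "measure \<mu> \<dots> = (\<Sum>\<xi>\<in>(\<Delta> \<rightarrow>\<^sub>E spin_set q) \<inter> B. measure \<mu> (spin_cylinder q \<Delta> \<xi>))"
  proof (rule finite_measure_finite_Union)
    show "finite ((\<Delta> \<rightarrow>\<^sub>E spin_set q) \<inter> B)"
      using \<Delta> by (intro finite_Int disjI1 finite_PiE finite_spin_set)
    show "disjoint_family_on (spin_cylinder q \<Delta>) ((\<Delta> \<rightarrow>\<^sub>E spin_set q) \<inter> B)"
      unfolding disjoint_family_on_def
    proof (intro ballI impI)
      fix \<xi> \<xi>' assume "\<xi> \<in> (\<Delta> \<rightarrow>\<^sub>E spin_set q) \<inter> B" "\<xi>' \<in> (\<Delta> \<rightarrow>\<^sub>E spin_set q) \<inter> B" "\<xi> \<noteq> \<xi>'"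
      then have "\<not> (\<sigma> \<in> spin_cylinder q \<Delta> \<xi> \<and> \<sigma> \<in> spin_cylinder q \<Delta> \<xi>')" for \<sigma>
        using spin_cylinder_restrict[of \<sigma> q _ \<Delta>] by (auto simp: spin_cylinder_def)
      then show "spin_cylinder q \<Delta> \<xi> \<inter> spin_cylinder q \<Delta> \<xi>' = {}"
        by blast
    qed
  qed (use spin_cylinder_in_sets[OF \<Delta>] \<mu>(2) in auto)
  finally show ?thesis .
qed

text \<open>
  There are countably many cylinders on finite sets, and the probability of each lies in \<open>[0, 1]\<close>: a diagonal sequence
  makes all of them converge.
\<close>

lemma cylinder_convergent_subsequence:
  fixes \<mu> :: "nat \<Rightarrow> (int ^ 'd::finite \<Rightarrow> real) measure"
  assumes \<mu>: "\<And>n. prob_space (\<mu> n)"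
  shows "\<exists>r. strict_mono r \<and> (\<forall>\<Delta> \<xi>. finite \<Delta> \<longrightarrow> \<xi> \<in> \<Delta> \<rightarrow>\<^sub>E spin_set q \<longrightarrow>
    convergent (\<lambda>n. measure (\<mu> (r n)) (spin_cylinder q \<Delta> \<xi>)))"
proof -
  define C where "C = (SIGMA \<Delta>:{\<Delta> :: (int ^ 'd) set. finite \<Delta>}. \<Delta> \<rightarrow>\<^sub>E spin_set q)"
  have "countable C"
    unfolding C_def
    by (intro countable_SIGMA countable_Collect_finite countable_finite finite_PiE finite_spin_set) auto
  define g where "g k n = measure (\<mu> n) (case from_nat_into C k of (\<Delta>, \<xi>) \<Rightarrow> spin_cylinder q \<Delta> \<xi>)" for k n
  define P where "P k s \<longleftrightarrow> convergent (\<lambda>n. g k (s n))" for k and s :: "nat \<Rightarrow> nat"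
  interpret subseqs P
  proof
    fix k and s :: "nat \<Rightarrow> nat"
    have "bounded (range (\<lambda>n. g k (s n)))"
      unfolding bounded_iff g_def
      by (intro exI[of _ 1]) (auto simp: prob_space.prob_le_1[OF \<mu>])
    then obtain l r where "strict_mono (r :: nat \<Rightarrow> nat)" "((\<lambda>n. g k (s n)) \<circ> r) \<longlonglongrightarrow> l"
      using bounded_imp_convergent_subsequence by blast
    then show "\<exists>r'. strict_mono r' \<and> P k (s \<circ> r')"
      by (auto simp: P_def convergent_def o_def)
  qed
  have "P k (diagseq \<circ> (+) (Suc k))" for k
    by (rule diagseq_holds)
       (auto simp: P_def o_def intro: convergent_subseq_convergent[unfolded o_def])
  then have conv: "convergent (\<lambda>n. g k (diagseq n))" for k
    using convergent_ignore_initial_segment[of "\<lambda>n. g k (diagseq n)" "Suc k"]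
    by (simp only: P_def o_def add.commute[of _ "Suc k"])
  show ?thesis
  proof (intro exI[of _ diagseq] conjI subseq_diagseq allI impI)
    fix \<Delta> and \<xi> :: "int ^ 'd \<Rightarrow> real"
    assume "finite \<Delta>" "\<xi> \<in> \<Delta> \<rightarrow>\<^sub>E spin_set q"
    then have "(\<Delta>, \<xi>) \<in> C"
      by (simp add: C_def)
    then have "from_nat_into C (to_nat_on C (\<Delta>, \<xi>)) = (\<Delta>, \<xi>)"
      using \<open>countable C\<close> by simp
    then show "convergent (\<lambda>n. measure (\<mu> (diagseq n)) (spin_cylinder q \<Delta> \<xi>))"
      using conv[of "to_nat_on C (\<Delta>, \<xi>)"] by (simp add: g_def)
  qed
qed

lemma measurable_spin_projection:
  assumes "q > 0"
  shows "(\<lambda>s. if s \<in> spin_set q then s else 0) \<in> measurable (borel :: real measure) (count_space (spin_set q))"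
proof -
  have "(\<lambda>s. if s \<in> spin_set q then s else 0) \<in> borel_measurable (borel :: real measure)"
    by (intro measurable_If) (auto intro!: borel_closed finite_imp_closed finite_spin_set)
  then have "(\<lambda>s. if s \<in> spin_set q then s else 0) -` {a} \<inter> space borel \<in> sets (borel :: real measure)" for a
    by (rule measurable_sets) simp
  then show ?thesis
    using zero_in_spin_set[OF assms]
    by (subst measurable_count_space_eq2) (auto simp: finite_spin_set)
qed

text \<open>
  The limits of the cylinder probabilities form a projective family of finite-dimensional laws, which
  Kolmogorov's extension theorem extends to the product of copies of the real line.  The extension charges only
  spins, coordinate by coordinate, so rounding each coordinate outside the spin set to 0 transports it to the
  configuration space without changing cylinder probabilities.
\<close>

lemma exists_measure_with_cylinder_limits:
  fixes \<mu> :: "nat \<Rightarrow> (int ^ 'd::finite \<Rightarrow> real) measure"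
  assumes q: "q > 0"
    and \<mu>: "\<And>n. prob_space (\<mu> n)" "\<And>n. sets (\<mu> n) = sets (config_space q)"
    and conv: "\<And>\<Delta> \<xi>. finite \<Delta> \<Longrightarrow> \<xi> \<in> \<Delta> \<rightarrow>\<^sub>E spin_set q \<Longrightarrow>
      convergent (\<lambda>n. measure (\<mu> n) (spin_cylinder q \<Delta> \<xi>))"
  shows "\<exists>\<nu>. prob_space \<nu> \<and> sets \<nu> = sets (config_space q) \<and>
    (\<forall>\<Delta> \<xi>. finite \<Delta> \<longrightarrow> \<xi> \<in> \<Delta> \<rightarrow>\<^sub>E spin_set q \<longrightarrow>
      (\<lambda>n. measure (\<mu> n) (spin_cylinder q \<Delta> \<xi>)) \<longlonglongrightarrow> measure \<nu> (spin_cylinder q \<Delta> \<xi>))"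
proof -
  define L where "L \<Delta> \<xi> = lim (\<lambda>n. measure (\<mu> n) (spin_cylinder q \<Delta> \<xi>))" for \<Delta> \<xi>
  have L: "(\<lambda>n. measure (\<mu> n) (spin_cylinder q \<Delta> \<xi>)) \<longlonglongrightarrow> L \<Delta> \<xi>"
    if "finite \<Delta>" "\<xi> \<in> \<Delta> \<rightarrow>\<^sub>E spin_set q" for \<Delta> \<xi>
    unfolding L_def using conv[OF that] by (simp add: convergent_LIMSEQ_iff)
  have L_nonneg: "0 \<le> L \<Delta> \<xi>" if "finite \<Delta>" "\<xi> \<in> \<Delta> \<rightarrow>\<^sub>E spin_set q" for \<Delta> \<xi>
    using L[OF that] by (rule LIMSEQ_le_const) auto
  define P where "P \<Delta> = distr (point_measure (\<Delta> \<rightarrow>\<^sub>E spin_set q) (\<lambda>\<xi>. ennreal (L \<Delta> \<xi>)))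
    (Pi\<^sub>M \<Delta> (\<lambda>_. borel)) (\<lambda>\<xi>. \<xi>)" for \<Delta> :: "(int ^ 'd) set"
  have sets_P: "sets (P \<Delta>) = sets (Pi\<^sub>M \<Delta> (\<lambda>_. borel))" "space (P \<Delta>) = space (Pi\<^sub>M \<Delta> (\<lambda>_. borel))" for \<Delta>
    by (simp_all add: P_def)
  have emeasure_P: "emeasure (P \<Delta>) B = ennreal (\<Sum>\<xi>\<in>(\<Delta> \<rightarrow>\<^sub>E spin_set q) \<inter> B. L \<Delta> \<xi>)"
    if \<Delta>: "finite \<Delta>" and B: "B \<in> sets (Pi\<^sub>M \<Delta> (\<lambda>_. borel))" for \<Delta> B
  proof -
    have fin: "finite (\<Delta> \<rightarrow>\<^sub>E spin_set q)"
      using \<Delta> by (intro finite_PiE finite_spin_set)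
    have "emeasure (P \<Delta>) B = emeasure (point_measure (\<Delta> \<rightarrow>\<^sub>E spin_set q) (\<lambda>\<xi>. ennreal (L \<Delta> \<xi>)))
        (B \<inter> (\<Delta> \<rightarrow>\<^sub>E spin_set q))"
      unfolding P_def using B
      by (subst emeasure_distr) (auto simp: measurable_def space_point_measure sets_point_measure space_PiM)
    also have "\<dots> = (\<Sum>\<xi>\<in>B \<inter> (\<Delta> \<rightarrow>\<^sub>E spin_set q). ennreal (L \<Delta> \<xi>))"
      using fin by (intro emeasure_point_measure_finite) auto
    also have "\<dots> = ennreal (\<Sum>\<xi>\<in>(\<Delta> \<rightarrow>\<^sub>E spin_set q) \<inter> B. L \<Delta> \<xi>)"
      using L_nonneg[OF \<Delta>] by (subst sum_ennreal) (auto simp: Int_commute)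
    finally show ?thesis .
  qed
  \<comment> \<open>Each finite-dimensional law is a limit of marginals, so consistency and total mass 1 are inherited
      from the marginals by uniqueness of limits.\<close>
  have lim_P: "(\<lambda>n. measure (\<mu> n) {\<sigma> \<in> space (config_space q). restrict \<sigma> \<Delta> \<in> B})
      \<longlonglongrightarrow> (\<Sum>\<xi>\<in>(\<Delta> \<rightarrow>\<^sub>E spin_set q) \<inter> B. L \<Delta> \<xi>)" if \<Delta>: "finite \<Delta>" for \<Delta> B
    unfolding measure_restrict_eq_sum[OF \<Delta> \<mu>] using \<Delta> by (intro tendsto_sum L) auto
  interpret pf: polish_projective UNIV P
  proof (intro polish_projective.intro projective_family.intro)
    fix J H :: "(int ^ 'd) set"
    assume JH: "J \<subseteq> H" "finite H"
    then have J: "finite J"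
      by (rule finite_subset)
    show "P J = distr (P H) (Pi\<^sub>M J (\<lambda>_. borel)) (\<lambda>f. restrict f J)"
    proof (rule measure_eqI)
      fix B assume "B \<in> sets (P J)"
      then have B: "B \<in> sets (Pi\<^sub>M J (\<lambda>_. borel))"
        by (simp add: sets_P)
      have meas: "(\<lambda>f. restrict f J) \<in> measurable (Pi\<^sub>M H (\<lambda>_. borel)) (Pi\<^sub>M J (\<lambda>_. borel :: real measure))"
        using JH(1) by (rule measurable_restrict_subset)
      let ?B = "(\<lambda>f. restrict f J) -` B \<inter> space (Pi\<^sub>M H (\<lambda>_. borel :: real measure))"
      have B': "?B \<in> sets (Pi\<^sub>M H (\<lambda>_. borel))"
        using meas B by (rule measurable_sets)
      have "emeasure (distr (P H) (Pi\<^sub>M J (\<lambda>_. borel)) (\<lambda>f. restrict f J)) B = emeasure (P H) ?B"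
        using meas B by (subst emeasure_distr) (auto simp: sets_P cong: measurable_cong_sets)
      also have "\<dots> = emeasure (P J) B"
      proof -
        have "restrict \<sigma> H \<in> ?B \<longleftrightarrow> restrict \<sigma> J \<in> B" for \<sigma> :: "int ^ 'd \<Rightarrow> real"
          using JH(1) by (simp add: space_PiM Int_absorb1)
        then have "(\<Sum>\<xi>\<in>(H \<rightarrow>\<^sub>E spin_set q) \<inter> ?B. L H \<xi>) = (\<Sum>\<xi>\<in>(J \<rightarrow>\<^sub>E spin_set q) \<inter> B. L J \<xi>)"
          using LIMSEQ_unique[OF lim_P[OF JH(2), of ?B]] lim_P[OF J, of B] by simp
        then show ?thesis
          by (simp only: emeasure_P[OF JH(2) B'] emeasure_P[OF J B])
      qed
      finally show "emeasure (P J) B = emeasure (distr (P H) (Pi\<^sub>M J (\<lambda>_. borel)) (\<lambda>f. restrict f J)) B" ..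
    qed (simp add: sets_P)
  next
    fix J :: "(int ^ 'd) set"
    assume J: "finite J"
    show "prob_space (P J)"
    proof (rule prob_spaceI)
      have "measure (\<mu> n) {\<sigma> \<in> space (config_space q). restrict \<sigma> J \<in> space (Pi\<^sub>M J (\<lambda>_. borel :: real measure))} = 1" for n
      proof -
        have "{\<sigma> \<in> space (config_space q). restrict \<sigma> J \<in> space (Pi\<^sub>M J (\<lambda>_. borel :: real measure))} = space (\<mu> n)"
          using sets_eq_imp_space_eq[OF \<mu>(2)] by (auto simp: space_PiM)
        then show ?thesis
          using prob_space.prob_space[OF \<mu>(1)] by simp
      qed
      then have "(\<Sum>\<xi>\<in>(J \<rightarrow>\<^sub>E spin_set q) \<inter> space (Pi\<^sub>M J (\<lambda>_. borel)). L J \<xi>) = 1"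
        using LIMSEQ_unique[OF lim_P[OF J, of "space (Pi\<^sub>M J (\<lambda>_. borel))"]] by simp
      then show "emeasure (P J) (space (P J)) = 1"
        by (simp add: sets_P emeasure_P[OF J])
    qed
  qed
  define g where "g s = (if s \<in> spin_set q then s else 0)" for s :: real
  have g: "g \<in> measurable borel (count_space (spin_set q))"
    unfolding g_def by (rule measurable_spin_projection[OF q])
  have G: "(\<lambda>\<sigma> x. g (\<sigma> x)) \<in> measurable (Pi\<^sub>M UNIV (\<lambda>_. borel))
      (config_space q :: (int ^ 'd \<Rightarrow> real) measure)"
    unfolding config_space_def
  proof (rule measurable_PiM_single'[where f = "\<lambda>x \<sigma>. g (\<sigma> x)"])
    fix x :: "int ^ 'd"
    have "(\<lambda>\<sigma>. \<sigma> x) \<in> measurable (Pi\<^sub>M UNIV (\<lambda>_. borel)) (borel :: real measure)"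
      using measurable_component_singleton[of x UNIV "\<lambda>_. borel"] by simp
    then show "(\<lambda>\<sigma>. g (\<sigma> x)) \<in> measurable (Pi\<^sub>M UNIV (\<lambda>_. borel)) (count_space (spin_set q))"
      using g by (rule measurable_compose)
  qed (use measurable_space[OF g] in auto)
  define \<nu> where "\<nu> = distr pf.lim (config_space q) (\<lambda>\<sigma> x. g (\<sigma> x))"
  have "prob_space \<nu>"
    unfolding \<nu>_def using G by (intro pf.P.prob_space_distr) (simp cong: measurable_cong_sets)
  moreover have "measure \<nu> (spin_cylinder q \<Delta> \<xi>) = L \<Delta> \<xi>"
    if \<Delta>: "finite \<Delta>" and \<xi>: "\<xi> \<in> \<Delta> \<rightarrow>\<^sub>E spin_set q" for \<Delta> \<xi>
  proof -
    let ?B = "{\<tau> \<in> space (Pi\<^sub>M \<Delta> (\<lambda>_. borel :: real measure)). \<forall>x\<in>\<Delta>. \<tau> x \<in> g -` {\<xi> x} \<inter> space borel}"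
    have B: "?B \<in> sets (Pi\<^sub>M \<Delta> (\<lambda>_. borel))"
    proof (rule sets.sets_Collect_finite_All)
      fix x assume x: "x \<in> \<Delta>"
      have "g -` {\<xi> x} \<inter> space borel \<in> sets borel"
        using \<xi> x by (intro measurable_sets[OF g]) auto
      then show "{\<tau> \<in> space (Pi\<^sub>M \<Delta> (\<lambda>_. borel)). \<tau> x \<in> g -` {\<xi> x} \<inter> space borel} \<in> sets (Pi\<^sub>M \<Delta> (\<lambda>_. borel))"
        using x by (intro sets_Collect_single') (simp_all add: vimage_def)
    qed fact
    have gS: "g s = s" if "s \<in> spin_set q" for s
      using that by (simp add: g_def)
    have "(\<lambda>\<sigma> x. g (\<sigma> x)) -` spin_cylinder q \<Delta> \<xi> \<inter> space pf.lim = prod_emb UNIV (\<lambda>_. borel) \<Delta> ?B"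
      using measurable_space[OF g]
      by (auto simp: spin_cylinder_def prod_emb_def space_PiM space_config_space)
    then have "emeasure \<nu> (spin_cylinder q \<Delta> \<xi>) = emeasure pf.lim (prod_emb UNIV (\<lambda>_. borel) \<Delta> ?B)"
      unfolding \<nu>_def using G spin_cylinder_in_sets[OF \<Delta>]
      by (subst emeasure_distr) (auto cong: measurable_cong_sets)
    also have "\<dots> = emeasure (P \<Delta>) ?B"
      using \<Delta> B by (intro pf.emeasure_lim_emb) auto
    also have "\<dots> = ennreal (\<Sum>\<xi>'\<in>(\<Delta> \<rightarrow>\<^sub>E spin_set q) \<inter> ?B. L \<Delta> \<xi>')"
      by (rule emeasure_P[OF \<Delta> B])
    also have "(\<Delta> \<rightarrow>\<^sub>E spin_set q) \<inter> ?B = {\<xi>}"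
    proof (intro set_eqI iffI)
      fix \<tau> assume \<tau>: "\<tau> \<in> (\<Delta> \<rightarrow>\<^sub>E spin_set q) \<inter> ?B"
      then have "\<tau> x = \<xi> x" if "x \<in> \<Delta>" for x
        using gS[of "\<tau> x"] PiE_mem[of \<tau> \<Delta> "\<lambda>_. spin_set q" x] that by auto
      then show "\<tau> \<in> {\<xi>}"
        using \<tau> \<xi> PiE_ext[of \<tau> \<Delta> "\<lambda>_. spin_set q" \<xi>] by auto
    next
      fix \<tau> assume "\<tau> \<in> {\<xi>}"
      then show "\<tau> \<in> (\<Delta> \<rightarrow>\<^sub>E spin_set q) \<inter> ?B"
        using \<xi> gS by (auto simp: space_PiM PiE_def Pi_def)
    qed
    finally show ?thesis
      using L_nonneg[OF \<Delta> \<xi>] by (simp add: measure_def)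
  qed
  ultimately show ?thesis
    using L by (intro exI[of _ \<nu>]) (auto simp: \<nu>_def)
qed

theorem config_measures_sequentially_compact:
  fixes \<mu> :: "nat \<Rightarrow> (int ^ 'd::finite \<Rightarrow> real) measure"
  assumes q: "q > 0"
    and \<mu>: "\<And>n. prob_space (\<mu> n)" "\<And>n. sets (\<mu> n) = sets (config_space q)"
  obtains r \<nu> where "strict_mono r" "prob_space \<nu>" "sets \<nu> = sets (config_space q)"
    and "\<And>f. local_function q f \<Longrightarrow> (\<lambda>n. \<integral>\<sigma>. f \<sigma> \<partial>\<mu> (r n)) \<longlonglongrightarrow> (\<integral>\<sigma>. f \<sigma> \<partial>\<nu>)"
proof -
  obtain r where r: "strict_mono r"
    "\<And>\<Delta> \<xi>. finite \<Delta> \<Longrightarrow> \<xi> \<in> \<Delta> \<rightarrow>\<^sub>E spin_set q \<Longrightarrow>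
      convergent (\<lambda>n. measure (\<mu> (r n)) (spin_cylinder q \<Delta> \<xi>))"
    using cylinder_convergent_subsequence[of \<mu> q, OF \<mu>(1)] by blast
  from exists_measure_with_cylinder_limits[OF q \<mu> r(2)]
  obtain \<nu> where \<nu>: "prob_space \<nu>" "sets \<nu> = sets (config_space q)"
    "\<And>\<Delta> \<xi>. finite \<Delta> \<Longrightarrow> \<xi> \<in> \<Delta> \<rightarrow>\<^sub>E spin_set q \<Longrightarrow>
      (\<lambda>n. measure (\<mu> (r n)) (spin_cylinder q \<Delta> \<xi>)) \<longlonglongrightarrow> measure \<nu> (spin_cylinder q \<Delta> \<xi>)"
    by blast
  show thesis
  proof (rule that[OF r(1) \<nu>(1,2)])
    fix f :: "(int ^ 'd \<Rightarrow> real) \<Rightarrow> real"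
    assume "local_function q f"
    then obtain \<Delta> where \<Delta>: "finite \<Delta>" "depends_on q \<Delta> f"
      by (auto simp: local_function_iff)
    show "(\<lambda>n. \<integral>\<sigma>. f \<sigma> \<partial>\<mu> (r n)) \<longlonglongrightarrow> (\<integral>\<sigma>. f \<sigma> \<partial>\<nu>)"
      unfolding integral_depends_on[OF q \<Delta> \<nu>(1,2)] integral_depends_on[OF q \<Delta> \<mu>]
      using \<Delta>(1) by (intro tendsto_sum tendsto_mult tendsto_const \<nu>(3)) auto
  qed
qed

section \<open>Gibbs measures as limits of finite-volume measures\<close>

lemma agreeing_configs_subset: "agreeing_configs q \<Lambda> \<eta> \<subseteq> space (config_space q)"
  by (auto simp: agreeing_configs_def)

lemma boundary_in_agreeing_configs:
  "\<eta> \<in> space (config_space q) \<Longrightarrow> \<eta> \<in> agreeing_configs q \<Lambda> \<eta>"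
  by (simp add: agreeing_configs_def)

lemma partition_fun_pos:
  fixes \<Lambda> :: "(int ^ 'd::finite) set"
  assumes "finite \<Lambda>" "\<eta> \<in> space (config_space q)"
  shows "0 < partition_fun q \<beta> \<Lambda> J \<eta>"
  unfolding partition_fun_def
  using boundary_in_agreeing_configs[OF assms(2)] finite_agreeing_configs[OF assms(1)]
  by (intro sum_pos) auto

lemma sets_specification_measure: "sets (specification_measure q \<beta> \<Lambda> J \<eta>) = sets (config_space q)"
  by (simp add: specification_measure_def)

lemma measurable_inclusion:
  "(\<lambda>\<sigma>. \<sigma>) \<in> measurable (point_measure (agreeing_configs q \<Lambda> \<eta>) g) (config_space q)"
  using agreeing_configs_subset[of q \<Lambda> \<eta>]
  by (auto simp: measurable_def space_point_measure sets_point_measure)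

lemma prob_space_specification_measure:
  fixes \<Lambda> :: "(int ^ 'd::finite) set"
  assumes \<Lambda>: "finite \<Lambda>" and \<eta>: "\<eta> \<in> space (config_space q)"
  shows "prob_space (specification_measure q \<beta> \<Lambda> J \<eta>)"
proof -
  let ?A = "agreeing_configs q \<Lambda> \<eta>" and ?Z = "partition_fun q \<beta> \<Lambda> J \<eta>"
  let ?g = "\<lambda>\<sigma>. exp (- \<beta> * hamiltonian \<Lambda> J \<sigma>) / ?Z"
  have Z: "0 < ?Z"
    by (rule partition_fun_pos[OF assms])
  have "prob_space (point_measure ?A (\<lambda>\<sigma>. ennreal (?g \<sigma>)))"
  proof (rule prob_spaceI)
    have "emeasure (point_measure ?A (\<lambda>\<sigma>. ennreal (?g \<sigma>))) ?A = (\<Sum>\<sigma>\<in>?A. ennreal (?g \<sigma>))"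
      using finite_agreeing_configs[OF \<Lambda>] by (intro emeasure_point_measure_finite) auto
    also have "\<dots> = ennreal (\<Sum>\<sigma>\<in>?A. ?g \<sigma>)"
      using Z by (intro sum_ennreal) auto
    also have "(\<Sum>\<sigma>\<in>?A. ?g \<sigma>) = 1"
      using Z by (simp add: partition_fun_def flip: sum_divide_distrib)
    finally show "emeasure (point_measure ?A (\<lambda>\<sigma>. ennreal (?g \<sigma>)))
        (space (point_measure ?A (\<lambda>\<sigma>. ennreal (?g \<sigma>)))) = 1"
      by (simp add: space_point_measure)
  qed
  then show ?thesis
    unfolding specification_measure_def
    by (rule prob_space.prob_space_distr[OF _ measurable_inclusion])
qed

lemma integral_specification_measure:
  fixes \<Lambda> :: "(int ^ 'd::finite) set"
  assumes q: "q > 0" and \<Lambda>: "finite \<Lambda>" and \<eta>: "\<eta> \<in> space (config_space q)" and f: "local_function q f"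
  shows "(\<integral>\<sigma>. f \<sigma> \<partial>specification_measure q \<beta> \<Lambda> J \<eta>) =
    (\<Sum>\<sigma>\<in>agreeing_configs q \<Lambda> \<eta>. f \<sigma> * exp (- \<beta> * hamiltonian \<Lambda> J \<sigma>)) / partition_fun q \<beta> \<Lambda> J \<eta>"
proof -
  have "f \<in> borel_measurable (config_space q)"
    using f depends_on_measurable[OF q] by (auto simp: local_function_iff)
  then have "(\<integral>\<sigma>. f \<sigma> \<partial>specification_measure q \<beta> \<Lambda> J \<eta>) =
      (\<integral>\<sigma>. f \<sigma> \<partial>point_measure (agreeing_configs q \<Lambda> \<eta>)
        (\<lambda>\<sigma>. ennreal (exp (- \<beta> * hamiltonian \<Lambda> J \<sigma>) / partition_fun q \<beta> \<Lambda> J \<eta>)))"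
    unfolding specification_measure_def by (rule integral_distr[OF measurable_inclusion])
  also have "\<dots> = (\<Sum>\<sigma>\<in>agreeing_configs q \<Lambda> \<eta>.
      exp (- \<beta> * hamiltonian \<Lambda> J \<sigma>) / partition_fun q \<beta> \<Lambda> J \<eta> * f \<sigma>)"
    using partition_fun_pos[OF \<Lambda> \<eta>, of \<beta> J] finite_agreeing_configs[OF \<Lambda>]
    by (subst lebesgue_integral_point_measure_finite) auto
  finally show ?thesis
    by (simp add: sum_divide_distrib mult.commute)
qed

lemma bond_energy_cong:
  assumes "e \<in> lattice_edges" "\<And>x. x \<in> e \<Longrightarrow> \<sigma> x = \<tau> x"
  shows "bond_energy \<sigma> e = bond_energy \<tau> e"
  using assms by (elim lattice_edgeE) (simp add: bond_energy_pair)

text \<open>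
  The difference of the two Hamiltonians involves only edges that do not touch \<open>\<Lambda>\<close>, where \<open>\<sigma>\<close> and
  \<open>\<tau>\<close> coincide.
\<close>

lemma hamiltonian_exchange:
  fixes \<Lambda> \<Lambda>' :: "(int ^ 'd::finite) set"
  assumes "\<Lambda> \<subseteq> \<Lambda>'" "finite \<Lambda>'" and agree: "\<And>x. x \<notin> \<Lambda> \<Longrightarrow> \<sigma> x = \<tau> x"
  shows "hamiltonian \<Lambda>' J \<tau> + hamiltonian \<Lambda> J \<sigma> = hamiltonian \<Lambda>' J \<sigma> + hamiltonian \<Lambda> J \<tau>"
proof -
  let ?T = "\<lambda>\<Lambda>. {e \<in> lattice_edges. e \<inter> \<Lambda> \<noteq> {}}"
  have "?T \<Lambda> \<subseteq> ?T \<Lambda>'"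
    using assms(1) by auto
  then have "hamiltonian \<Lambda>' J \<rho> = (\<Sum>e\<in>?T \<Lambda>' - ?T \<Lambda>. of_bool (J e) * bond_energy \<rho> e) + hamiltonian \<Lambda> J \<rho>" for \<rho>
    unfolding hamiltonian_def by (rule sum.subset_diff) (rule finite_edges_touching[OF assms(2)])
  moreover have "(\<Sum>e\<in>?T \<Lambda>' - ?T \<Lambda>. of_bool (J e) * bond_energy \<sigma> e) =
      (\<Sum>e\<in>?T \<Lambda>' - ?T \<Lambda>. of_bool (J e) * bond_energy \<tau> e)"
    by (intro sum.cong refl arg_cong2[where f = "(*)"] bond_energy_cong agree) auto
  ultimately show ?thesis
    by simp
qed

text \<open>
  Write \<open>\<sigma> \<sim> \<tau>\<close> if the configurations agree off \<open>\<Lambda>\<close>.  The relation is symmetric, the partition sum depends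
  only on the class, and \<open>hamiltonian_exchange\<close> allows the weights of \<open>\<sigma>\<close> and \<open>\<tau>\<close> to be exchanged; then the
  inner sum, taken over \<open>\<tau>\<close> instead of \<open>\<sigma>\<close>, cancels the partition sum.
\<close>

lemma specification_consistent:
  fixes \<Lambda> \<Lambda>' :: "(int ^ 'd::finite) set"
  assumes sub: "\<Lambda> \<subseteq> \<Lambda>'" and fin: "finite \<Lambda>'" and \<eta>: "\<eta> \<in> space (config_space q)"
  shows "(\<Sum>\<tau>\<in>agreeing_configs q \<Lambda>' \<eta>.
      (\<Sum>\<sigma>\<in>agreeing_configs q \<Lambda> \<tau>. f \<sigma> * exp (- \<beta> * hamiltonian \<Lambda> J \<sigma>)) / partition_fun q \<beta> \<Lambda> J \<tau>
        * exp (- \<beta> * hamiltonian \<Lambda>' J \<tau>)) =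
    (\<Sum>\<sigma>\<in>agreeing_configs q \<Lambda>' \<eta>. f \<sigma> * exp (- \<beta> * hamiltonian \<Lambda>' J \<sigma>))"
proof -
  let ?A = "agreeing_configs q \<Lambda>' \<eta>"
  let ?R = "\<lambda>\<tau> \<sigma>. \<forall>x. x \<notin> \<Lambda> \<longrightarrow> \<sigma> x = \<tau> x"
  let ?w = "\<lambda>\<Lambda> \<sigma>. exp (- \<beta> * hamiltonian \<Lambda> J \<sigma>)"
  let ?Z = "partition_fun q \<beta> \<Lambda> J"
  have A: "finite ?A"
    by (rule finite_agreeing_configs[OF fin])
  have \<Lambda>: "finite \<Lambda>"
    using sub fin by (rule finite_subset)
  have inner: "agreeing_configs q \<Lambda> \<tau> = {\<sigma>. \<sigma> \<in> ?A \<and> ?R \<tau> \<sigma>}" if "\<tau> \<in> ?A" for \<tau>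
    using that sub by (auto simp: agreeing_configs_def)
  have Z_eq: "?Z \<sigma> = ?Z \<tau>" if "?R \<tau> \<sigma>" for \<sigma> \<tau>
  proof -
    have "agreeing_configs q \<Lambda> \<sigma> = agreeing_configs q \<Lambda> \<tau>"
      using that by (auto simp: agreeing_configs_def)
    then show ?thesis
      by (simp add: partition_fun_def)
  qed
  have exchange: "?w \<Lambda> \<sigma> * ?w \<Lambda>' \<tau> = ?w \<Lambda>' \<sigma> * ?w \<Lambda> \<tau>" if "?R \<tau> \<sigma>" for \<sigma> \<tau>
  proof -
    have "hamiltonian \<Lambda>' J \<tau> + hamiltonian \<Lambda> J \<sigma> = hamiltonian \<Lambda>' J \<sigma> + hamiltonian \<Lambda> J \<tau>"
      using that by (intro hamiltonian_exchange sub fin) blast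
    then have "- \<beta> * hamiltonian \<Lambda> J \<sigma> + - \<beta> * hamiltonian \<Lambda>' J \<tau> =
        - \<beta> * hamiltonian \<Lambda>' J \<sigma> + - \<beta> * hamiltonian \<Lambda> J \<tau>"
      by (simp only: distrib_left[symmetric] add.commute)
    then show ?thesis
      by (simp only: exp_add[symmetric])
  qed
  have "(\<Sum>\<tau>\<in>?A. (\<Sum>\<sigma>\<in>agreeing_configs q \<Lambda> \<tau>. f \<sigma> * ?w \<Lambda> \<sigma>) / ?Z \<tau> * ?w \<Lambda>' \<tau>) =
      (\<Sum>\<tau>\<in>?A. \<Sum>\<sigma>\<in>{\<sigma>. \<sigma> \<in> ?A \<and> ?R \<tau> \<sigma>}. f \<sigma> * ?w \<Lambda>' \<sigma> / ?Z \<sigma> * ?w \<Lambda> \<tau>)"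
    unfolding sum_divide_distrib sum_distrib_right
  proof (intro sum.cong refl inner)
    fix \<tau> \<sigma> assume "\<sigma> \<in> {\<sigma>. \<sigma> \<in> ?A \<and> ?R \<tau> \<sigma>}"
    then have R: "?R \<tau> \<sigma>"
      by simp
    show "f \<sigma> * ?w \<Lambda> \<sigma> / ?Z \<tau> * ?w \<Lambda>' \<tau> = f \<sigma> * ?w \<Lambda>' \<sigma> / ?Z \<sigma> * ?w \<Lambda> \<tau>"
      using exchange[OF R] unfolding Z_eq[OF R] by (simp add: field_simps)
  qed
  also have "\<dots> = (\<Sum>\<sigma>\<in>?A. \<Sum>\<tau>\<in>{\<tau>. \<tau> \<in> ?A \<and> ?R \<tau> \<sigma>}. f \<sigma> * ?w \<Lambda>' \<sigma> / ?Z \<sigma> * ?w \<Lambda> \<tau>)"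
    by (rule sum.swap_restrict[OF A A])
  also have "\<dots> = (\<Sum>\<sigma>\<in>?A. f \<sigma> * ?w \<Lambda>' \<sigma>)"
  proof (intro sum.cong refl)
    fix \<sigma> assume \<sigma>: "\<sigma> \<in> ?A"
    then have "0 < ?Z \<sigma>"
      using agreeing_configs_subset[of q \<Lambda>' \<eta>] by (intro partition_fun_pos \<Lambda>) auto
    moreover have "{\<tau>. \<tau> \<in> ?A \<and> ?R \<tau> \<sigma>} = agreeing_configs q \<Lambda> \<sigma>"
      unfolding inner[OF \<sigma>] by (auto simp: eq_commute)
    ultimately show "(\<Sum>\<tau>\<in>{\<tau>. \<tau> \<in> ?A \<and> ?R \<tau> \<sigma>}. f \<sigma> * ?w \<Lambda>' \<sigma> / ?Z \<sigma> * ?w \<Lambda> \<tau>) = f \<sigma> * ?w \<Lambda>' \<sigma>"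
      by (simp only: sum_distrib_left[symmetric] partition_fun_def[of q \<beta> \<Lambda> J \<sigma>, symmetric]) simp
  qed
  finally show ?thesis .
qed

text \<open>
  The finite-volume expectation sees the boundary condition only where \<open>f\<close> depends on the spin and at
  the endpoints of the edges that touch \<open>\<Lambda>\<close>.  This is what allows the Gibbs equation to pass to the limit.
\<close>

lemma local_function_specification:
  fixes \<Lambda> :: "(int ^ 'd::finite) set"
  assumes q: "q > 0" and \<Lambda>: "finite \<Lambda>" and f: "local_function q f"
  shows "local_function q (\<lambda>\<eta>. \<integral>\<sigma>. f \<sigma> \<partial>specification_measure q \<beta> \<Lambda> J \<eta>)"
proof -
  obtain \<Delta> where \<Delta>: "finite \<Delta>" "depends_on q \<Delta> f"
    using f by (auto simp: local_function_iff)
  let ?T = "{e \<in> lattice_edges. e \<inter> \<Lambda> \<noteq> {}}"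
  have "finite (\<Union>?T)"
    using finite_edges_touching[OF \<Lambda>] by (intro finite_Union) (auto elim!: lattice_edgeE)
  moreover have "depends_on q (\<Delta> \<union> \<Union>?T) (\<lambda>\<eta>. \<integral>\<sigma>. f \<sigma> \<partial>specification_measure q \<beta> \<Lambda> J \<eta>)"
    unfolding depends_on_def
  proof (intro ballI impI)
    fix \<eta> \<eta>' :: "int ^ 'd \<Rightarrow> real"
    assume \<eta>: "\<eta> \<in> space (config_space q)" and \<eta>': "\<eta>' \<in> space (config_space q)"
      and eq: "\<forall>x\<in>\<Delta> \<union> \<Union>?T. \<eta> x = \<eta>' x"
    define glue where "glue \<eta> \<rho> x = (if x \<in> \<Lambda> then \<rho> x else \<eta> x)" for \<eta> \<rho> :: "int ^ 'd \<Rightarrow> real" and x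
    have sum_glue: "sum g (agreeing_configs q \<Lambda> \<eta>) = (\<Sum>\<rho>\<in>\<Lambda> \<rightarrow>\<^sub>E spin_set q. g (glue \<eta> \<rho>))"
      if "\<eta> \<in> space (config_space q)" for \<eta> and g :: "_ \<Rightarrow> real"
      using that by (subst sum_agreeing_configs) (auto simp: space_config_space glue_def[abs_def])
    have ham: "hamiltonian \<Lambda> J (glue \<eta> \<rho>) = hamiltonian \<Lambda> J (glue \<eta>' \<rho>)" for \<rho>
      unfolding hamiltonian_def
    proof (intro sum.cong refl arg_cong2[where f = "(*)"] bond_energy_cong)
      fix e x assume "e \<in> ?T" "x \<in> e"
      then have "x \<in> \<Delta> \<union> \<Union>?T"
        by blast
      then show "glue \<eta> \<rho> x = glue \<eta>' \<rho> x"
        using eq by (simp add: glue_def)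
    qed auto
    have feq: "f (glue \<eta> \<rho>) = f (glue \<eta>' \<rho>)" if "\<rho> \<in> \<Lambda> \<rightarrow>\<^sub>E spin_set q" for \<rho>
    proof (rule \<Delta>(2)[unfolded depends_on_def, rule_format])
      show "glue \<eta> \<rho> \<in> space (config_space q)" "glue \<eta>' \<rho> \<in> space (config_space q)"
        using \<eta> \<eta>' that by (auto simp: space_config_space glue_def)
      show "glue \<eta> \<rho> x = glue \<eta>' \<rho> x" if "x \<in> \<Delta>" for x
        using eq that by (simp add: glue_def)
    qed
    have "(\<Sum>\<sigma>\<in>agreeing_configs q \<Lambda> \<eta>. f \<sigma> * exp (- \<beta> * hamiltonian \<Lambda> J \<sigma>)) =
        (\<Sum>\<sigma>\<in>agreeing_configs q \<Lambda> \<eta>'. f \<sigma> * exp (- \<beta> * hamiltonian \<Lambda> J \<sigma>))"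
      unfolding sum_glue[OF \<eta>] sum_glue[OF \<eta>'] by (intro sum.cong refl) (simp only: ham feq)
    moreover have "partition_fun q \<beta> \<Lambda> J \<eta> = partition_fun q \<beta> \<Lambda> J \<eta>'"
      unfolding partition_fun_def sum_glue[OF \<eta>] sum_glue[OF \<eta>'] by (intro sum.cong refl) (simp only: ham)
    ultimately show "(\<integral>\<sigma>. f \<sigma> \<partial>specification_measure q \<beta> \<Lambda> J \<eta>) =
        (\<integral>\<sigma>. f \<sigma> \<partial>specification_measure q \<beta> \<Lambda> J \<eta>')"
      by (simp only: integral_specification_measure[OF q \<Lambda> \<eta> f] integral_specification_measure[OF q \<Lambda> \<eta>' f])
  qed
  ultimately show ?thesis
    using \<Delta>(1) unfolding local_function_iff by (intro exI[of _ "\<Delta> \<union> \<Union>?T"]) simp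
qed

lemma integral_specification_consistent:
  fixes \<Lambda> \<Lambda>' :: "(int ^ 'd::finite) set"
  assumes q: "q > 0" and sub: "\<Lambda> \<subseteq> \<Lambda>'" and fin: "finite \<Lambda>'" and \<eta>: "\<eta> \<in> space (config_space q)"
    and f: "local_function q f"
  shows "(\<integral>\<tau>. (\<integral>\<sigma>. f \<sigma> \<partial>specification_measure q \<beta> \<Lambda> J \<tau>) \<partial>specification_measure q \<beta> \<Lambda>' J \<eta>) =
    (\<integral>\<sigma>. f \<sigma> \<partial>specification_measure q \<beta> \<Lambda>' J \<eta>)"
proof -
  have \<Lambda>: "finite \<Lambda>"
    using sub fin by (rule finite_subset)
  have "(\<Sum>\<tau>\<in>agreeing_configs q \<Lambda>' \<eta>. (\<integral>\<sigma>. f \<sigma> \<partial>specification_measure q \<beta> \<Lambda> J \<tau>)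
        * exp (- \<beta> * hamiltonian \<Lambda>' J \<tau>)) =
      (\<Sum>\<tau>\<in>agreeing_configs q \<Lambda>' \<eta>.
        (\<Sum>\<sigma>\<in>agreeing_configs q \<Lambda> \<tau>. f \<sigma> * exp (- \<beta> * hamiltonian \<Lambda> J \<sigma>)) / partition_fun q \<beta> \<Lambda> J \<tau>
          * exp (- \<beta> * hamiltonian \<Lambda>' J \<tau>))"
    using agreeing_configs_subset[of q \<Lambda>' \<eta>]
    by (intro sum.cong refl arg_cong2[where f = "(*)"] integral_specification_measure[OF q \<Lambda> _ f]) auto
  also have "\<dots> = (\<Sum>\<sigma>\<in>agreeing_configs q \<Lambda>' \<eta>. f \<sigma> * exp (- \<beta> * hamiltonian \<Lambda>' J \<sigma>))"
    by (rule specification_consistent[OF sub fin \<eta>])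
  finally show ?thesis
    by (simp only: integral_specification_measure[OF q fin \<eta> local_function_specification[OF q \<Lambda> f]]
        integral_specification_measure[OF q fin \<eta> f])
qed

text \<open>
  The measure is a limit point of the finite-volume measures along an exhaustion of the lattice.  A fixed
  region \<open>K\<close> is eventually contained in the regions of the exhaustion, where the Gibbs equation for \<open>K\<close>
  holds by consistency; both of its sides are expectations of local functions and converge.
\<close>

theorem gibbs_measure_exists_with_boundary:
  fixes J :: "(int ^ 'd::finite) set \<Rightarrow> bool"
  assumes q: "q > 0" and \<eta>: "\<eta> \<in> space (config_space q)"
  shows "\<exists>\<nu>\<in>gibbs_measures q \<beta> J. \<forall>f c. local_function q f \<longrightarrow>
    (\<forall>\<Lambda>. finite \<Lambda> \<longrightarrow> c \<le> (\<integral>\<sigma>. f \<sigma> \<partial>specification_measure q \<beta> \<Lambda> J \<eta>)) \<longrightarrow> c \<le> (\<integral>\<sigma>. f \<sigma> \<partial>\<nu>)"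
proof -
  define \<Lambda> where "\<Lambda> n = {x :: int ^ 'd. to_nat x < n}" for n
  have fin: "finite (\<Lambda> n)" for n
    unfolding \<Lambda>_def using finite_vimageI[OF finite_lessThan inj_to_nat, of n] by (simp add: vimage_def)
  define \<mu> where "\<mu> n = specification_measure q \<beta> (\<Lambda> n) J \<eta>" for n
  have \<mu>: "prob_space (\<mu> n)" "sets (\<mu> n) = sets (config_space q)" for n
    unfolding \<mu>_def by (rule prob_space_specification_measure[OF fin \<eta>], rule sets_specification_measure)
  obtain r \<nu> where r: "strict_mono r" and \<nu>: "prob_space \<nu>" "sets \<nu> = sets (config_space q)"
    and lim: "\<And>f. local_function q f \<Longrightarrow> (\<lambda>n. \<integral>\<sigma>. f \<sigma> \<partial>\<mu> (r n)) \<longlonglongrightarrow> (\<integral>\<sigma>. f \<sigma> \<partial>\<nu>)"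
    using config_measures_sequentially_compact[of q \<mu>, OF q \<mu>] by blast
  have "(\<integral>\<sigma>. f \<sigma> \<partial>\<nu>) = (\<integral>\<eta>. (\<integral>\<sigma>. f \<sigma> \<partial>specification_measure q \<beta> K J \<eta>) \<partial>\<nu>)"
    if K: "finite K" and f: "local_function q f" for K f
  proof -
    let ?\<gamma>f = "\<lambda>\<tau>. \<integral>\<sigma>. f \<sigma> \<partial>specification_measure q \<beta> K J \<tau>"
    obtain N where N: "\<And>x. x \<in> K \<Longrightarrow> to_nat x < N"
      using finite_nat_bounded[OF finite_imageI[OF K, of to_nat]] by auto
    have "(\<integral>\<sigma>. f \<sigma> \<partial>\<mu> (r n)) = (\<integral>\<tau>. ?\<gamma>f \<tau> \<partial>\<mu> (r n))" if "n \<ge> N" for n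
    proof -
      have "N \<le> r n"
        using that seq_suble[OF r, of n] by simp
      then have "K \<subseteq> \<Lambda> (r n)"
        using N by (auto simp: \<Lambda>_def intro: less_le_trans)
      then show ?thesis
        unfolding \<mu>_def by (rule integral_specification_consistent[OF q _ fin \<eta> f, symmetric])
    qed
    then have "\<forall>\<^sub>F n in sequentially. (\<integral>\<tau>. ?\<gamma>f \<tau> \<partial>\<mu> (r n)) = (\<integral>\<sigma>. f \<sigma> \<partial>\<mu> (r n))"
      unfolding eventually_sequentially by (intro exI[of _ N]) simp
    then have "(\<lambda>n. \<integral>\<sigma>. f \<sigma> \<partial>\<mu> (r n)) \<longlonglongrightarrow> (\<integral>\<tau>. ?\<gamma>f \<tau> \<partial>\<nu>)"
      by (rule Lim_transform_eventually[OF lim[OF local_function_specification[OF q K f]]])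
    with lim[OF f] show ?thesis
      by (rule LIMSEQ_unique)
  qed
  with \<nu> have "\<nu> \<in> gibbs_measures q \<beta> J"
    by (simp add: gibbs_measures_def)
  moreover have "c \<le> (\<integral>\<sigma>. f \<sigma> \<partial>\<nu>)"
    if f: "local_function q f"
      and c: "\<forall>\<Lambda>. finite \<Lambda> \<longrightarrow> c \<le> (\<integral>\<sigma>. f \<sigma> \<partial>specification_measure q \<beta> \<Lambda> J \<eta>)" for f c
    using lim[OF f] by (rule LIMSEQ_le_const) (use c fin in \<open>auto simp: \<mu>_def\<close>)
  ultimately show ?thesis
    by blast
qed

section \<open>Phase co-existence\<close>

lemma local_function_spin_bias: "local_function q (spin_bias x a b)"
  unfolding local_function_def by (intro exI[of _ "{x}"]) (auto simp: spin_bias_def)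

lemma specification_spin_bias_ge:
  fixes \<Lambda> :: "(int ^ 'd::finite) set"
  assumes \<Lambda>: "finite \<Lambda>" and a: "a \<in> spin_set q" and b: "b \<in> spin_set q" "b \<noteq> a"
    and cost: "misaligned_weight q \<beta> \<le> 1" and r: "r \<in> {0..1}"
    and r_cost: "r * (2 * misaligned_weight q \<beta>) \<le> (1 - r) * (1 - misaligned_weight q \<beta>)"
  shows "bernoulli_sum r {e \<in> lattice_edges. e \<inter> \<Lambda> \<noteq> {} \<and> J e} (escapes \<Lambda> x)
    \<le> (\<integral>\<sigma>. spin_bias x a b \<sigma> \<partial>specification_measure q \<beta> \<Lambda> J (\<lambda>_. a))"
proof -
  let ?A = "agreeing_configs q \<Lambda> (\<lambda>_. a)"
  let ?T = "{e \<in> lattice_edges. e \<inter> \<Lambda> \<noteq> {}}"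
  let ?U = "{e \<in> lattice_edges. e \<inter> \<Lambda> \<noteq> {} \<and> J e}"
  have q: "q > 0"
    using a by (auto simp: spin_set_def)
  have \<eta>: "(\<lambda>_. a) \<in> space (config_space q)"
    using a by (simp add: space_config_space)
  have U: "finite ?U"
    using finite_edges_touching[OF \<Lambda>] by (rule rev_finite_subset) auto
  have weight: "exp (- \<beta> * hamiltonian \<Lambda> J \<sigma>) = (\<Prod>e\<in>?U. exp (- \<beta> * bond_energy \<sigma> e))" for \<sigma>
  proof -
    have "hamiltonian \<Lambda> J \<sigma> = (\<Sum>e\<in>?U. bond_energy \<sigma> e)"
      unfolding hamiltonian_def using finite_edges_touching[OF \<Lambda>]
      by (intro sum.mono_neutral_cong_right) auto
    then show ?thesis
      using U by (simp only: sum_distrib_left exp_sum)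
  qed
  have "bernoulli_sum r ?U (\<lambda>\<xi>. escapes \<Lambda> x ({} \<union> \<xi>)) *
      (\<Sum>\<sigma>\<in>?A. 1 * (\<Prod>e\<in>?U. exp (- \<beta> * bond_energy \<sigma> e)))
    \<le> (\<Sum>\<sigma>\<in>?A. 1 * (\<Prod>e\<in>?U. exp (- \<beta> * bond_energy \<sigma> e)) * spin_bias x a b \<sigma>)"
    by (rule spin_bias_ge_bernoulli_sum[OF \<Lambda> a b cost r r_cost U])
       (auto elim!: lattice_edgeE intro: positive_type_const)
  then have "bernoulli_sum r ?U (escapes \<Lambda> x) * partition_fun q \<beta> \<Lambda> J (\<lambda>_. a)
    \<le> (\<Sum>\<sigma>\<in>?A. spin_bias x a b \<sigma> * exp (- \<beta> * hamiltonian \<Lambda> J \<sigma>))"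
    unfolding partition_fun_def weight by (simp add: mult.commute)
  then show ?thesis
    unfolding integral_specification_measure[OF q \<Lambda> \<eta> local_function_spin_bias]
    using partition_fun_pos[OF \<Lambda> \<eta>, of \<beta> J] by (simp add: pos_le_divide_eq)
qed

text \<open>
  Each spin value \<open>a\<close> gives a Gibbs measure \<open>\<nu> a\<close> under which \<open>x\<close> takes the value \<open>a\<close> with probability exceeding that
  of any other value \<open>b\<close> by at least \<open>c > 0\<close>.  If \<open>\<nu> a = \<nu> b\<close>, the bias from \<open>a\<close> to \<open>b\<close> and its negative would both be
  positive.
\<close>

lemma gibbs_measures_lepoll:
  fixes J :: "(int ^ 'd::finite) set \<Rightarrow> bool"
  assumes q: "q > 0" and cost: "misaligned_weight q \<beta> \<le> 1" and r: "r \<in> {0..1}"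
    and r_cost: "r * (2 * misaligned_weight q \<beta>) \<le> (1 - r) * (1 - misaligned_weight q \<beta>)"
    and x: "0 < measure (disorder_law r)
      {K \<in> space (disorder_law r). infinite (open_cluster (\<lambda>e. J e \<and> K e) x)}" (is "0 < ?c")
  shows "{..<q} \<lesssim> gibbs_measures q \<beta> J"
proof -
  let ?s = "\<lambda>i. 2 * pi * real i / real q"
  have s: "?s i \<in> spin_set q" if "i < q" for i
    using that by (auto simp: spin_set_def)
  have "\<exists>\<nu>. \<nu> \<in> gibbs_measures q \<beta> J \<and>
      (\<forall>b\<in>spin_set q. b \<noteq> a \<longrightarrow> ?c \<le> (\<integral>\<sigma>. spin_bias x a b \<sigma> \<partial>\<nu>))"
    if a: "a \<in> spin_set q" for a
  proof -
    have \<eta>: "(\<lambda>_. a) \<in> space (config_space q)"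
      using a by (simp add: space_config_space)
    have "?c \<le> (\<integral>\<sigma>. spin_bias x a b \<sigma> \<partial>specification_measure q \<beta> \<Lambda> J (\<lambda>_. a))"
      if "finite \<Lambda>" "b \<in> spin_set q" "b \<noteq> a" for \<Lambda> b
      using infinite_cluster_prob_le[OF that(1) r] specification_spin_bias_ge[OF that(1) a that(2,3) cost r r_cost]
      by (rule order_trans)
    moreover obtain \<nu> where "\<nu> \<in> gibbs_measures q \<beta> J"
      and "\<forall>f c. local_function q f \<longrightarrow>
        (\<forall>\<Lambda>. finite \<Lambda> \<longrightarrow> c \<le> (\<integral>\<sigma>. f \<sigma> \<partial>specification_measure q \<beta> \<Lambda> J (\<lambda>_. a))) \<longrightarrow> c \<le> (\<integral>\<sigma>. f \<sigma> \<partial>\<nu>)"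
      using gibbs_measure_exists_with_boundary[OF q \<eta>, of \<beta> J] by (elim bexE)
    ultimately show ?thesis
      by (intro exI[of _ \<nu>] conjI ballI impI) (simp_all add: local_function_spin_bias)
  qed
  then have "\<forall>a\<in>spin_set q. \<exists>\<nu>. \<nu> \<in> gibbs_measures q \<beta> J \<and>
      (\<forall>b\<in>spin_set q. b \<noteq> a \<longrightarrow> ?c \<le> (\<integral>\<sigma>. spin_bias x a b \<sigma> \<partial>\<nu>))"
    by (rule ballI)
  from bchoice[OF this] obtain \<nu> where choice: "\<forall>a\<in>spin_set q. \<nu> a \<in> gibbs_measures q \<beta> J \<and>
      (\<forall>b\<in>spin_set q. b \<noteq> a \<longrightarrow> ?c \<le> (\<integral>\<sigma>. spin_bias x a b \<sigma> \<partial>\<nu> a))" ..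
  have \<nu>: "\<nu> a \<in> gibbs_measures q \<beta> J"
    "b \<in> spin_set q \<Longrightarrow> b \<noteq> a \<Longrightarrow> ?c \<le> (\<integral>\<sigma>. spin_bias x a b \<sigma> \<partial>\<nu> a)"
    if "a \<in> spin_set q" for a b
    using bspec[OF choice that] by simp_all
  have "inj_on \<nu> (spin_set q)"
  proof (rule inj_onI, rule ccontr)
    fix a b assume ab: "a \<in> spin_set q" "b \<in> spin_set q" "\<nu> a = \<nu> b" "a \<noteq> b"
    have "(\<integral>\<sigma>. spin_bias x b a \<sigma> \<partial>\<nu> b) = - (\<integral>\<sigma>. spin_bias x a b \<sigma> \<partial>\<nu> a)"
      unfolding ab(3) by (simp add: spin_bias_def flip: Bochner_Integration.integral_minus)
    with \<nu>(2)[of a b] \<nu>(2)[of b a] ab x show False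
      by simp
  qed
  then have "inj_on (\<lambda>i. \<nu> (?s i)) {..<q}"
    using inj_on_spin[of q] by (intro comp_inj_on[of ?s _ \<nu>, unfolded o_def]) (auto simp: spin_set_def)
  then show ?thesis
    unfolding lepoll_def using \<nu>(1) s by (intro exI[of _ "\<lambda>i. \<nu> (?s i)"]) auto
qed

theorem theorem1p1:
  fixes q :: nat and p :: real
  assumes "CARD('d::finite) \<ge> 2"
    and "q \<ge> 2"
    and "p \<in> {0..1}"
    and "p > critical_prob TYPE('d)"
  shows "\<exists>\<beta>\<^sub>0 > 0. \<forall>\<beta> > \<beta>\<^sub>0.
    AE J in (disorder_law p :: ((int ^ 'd) set \<Rightarrow> bool) measure).
      {..<q} \<lesssim> gibbs_measures q \<beta> J"
proof -
  obtain r where r: "0 \<le> r" "r < 1" "p * r > critical_prob TYPE('d)"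
  proof -
    \<comment> \<open>Room below 1 is needed because the guaranteed probability \<open>(1 - \<epsilon>) / (1 + \<epsilon>)\<close> of alignment is
        less than 1 at every finite \<open>\<beta>\<close>.\<close>
    have "((\<lambda>r. p * r) \<longlongrightarrow> p * 1) (at_left 1)"
      by (intro tendsto_intros)
    then have "\<forall>\<^sub>F r in at_left 1. critical_prob TYPE('d) < p * r"
      using assms(4) by (intro order_tendstoD) auto
    moreover have "\<forall>\<^sub>F r :: real in at_left 1. r \<in> {0<..<1}"
      by (rule eventually_at_left_real) simp
    ultimately have "\<forall>\<^sub>F r in at_left 1. critical_prob TYPE('d) < p * r \<and> r \<in> {0<..<1}"
      by (rule eventually_conj)
    then obtain r where "critical_prob TYPE('d) < p * r \<and> r \<in> {0<..<1}"
      using eventually_happens'[OF trivial_limit_at_left_real] by blast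
    then show thesis
      using that[of r] by auto
  qed
  \<comment> \<open>As \<open>\<beta>\<close> grows, \<open>\<epsilon>\<close> tends to 0, so any fixed \<open>r < 1\<close> is eventually admissible.\<close>
  have "((\<lambda>\<beta>. (1 - r) * (1 - misaligned_weight q \<beta>) - r * (2 * misaligned_weight q \<beta>)) \<longlongrightarrow>
      (1 - r) * (1 - 0) - r * (2 * 0)) at_top"
    by (intro tendsto_intros tendsto_misaligned_weight)
  then have "\<forall>\<^sub>F \<beta> in at_top. 0 < (1 - r) * (1 - misaligned_weight q \<beta>) - r * (2 * misaligned_weight q \<beta>)"
    using r by (intro order_tendstoD) auto
  moreover have "\<forall>\<^sub>F \<beta> in at_top. misaligned_weight q \<beta> < 1"
    using tendsto_misaligned_weight by (rule order_tendstoD) simp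
  ultimately have "\<forall>\<^sub>F \<beta> in at_top.
      r * (2 * misaligned_weight q \<beta>) \<le> (1 - r) * (1 - misaligned_weight q \<beta>) \<and> misaligned_weight q \<beta> \<le> 1"
    by eventually_elim simp
  then obtain \<beta>\<^sub>1 where \<beta>\<^sub>1: "\<And>\<beta>. \<beta> \<ge> \<beta>\<^sub>1 \<Longrightarrow>
      r * (2 * misaligned_weight q \<beta>) \<le> (1 - r) * (1 - misaligned_weight q \<beta>) \<and> misaligned_weight q \<beta> \<le> 1"
    by (auto simp: eventually_at_top_linorder)
  have r': "r \<in> {0..1}"
    using r by simp
  have "AE J in (disorder_law p :: ((int ^ 'd) set \<Rightarrow> bool) measure). {..<q} \<lesssim> gibbs_measures q \<beta> J"
    if \<beta>: "\<beta> > max 1 \<beta>\<^sub>1" for \<beta>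
    using AE_ex_infinite_thinned_cluster[OF assms(3) r' r(3)]
  proof eventually_elim
    case (elim J)
    then obtain x where "0 < measure (disorder_law r)
        {K \<in> space (disorder_law r). infinite (open_cluster (\<lambda>e. J e \<and> K e) x)}" ..
    with \<beta>\<^sub>1[of \<beta>] \<beta> assms(2) r' show ?case
      by (intro gibbs_measures_lepoll) simp_all
  qed
  then show ?thesis
    by (intro exI[of _ "max 1 \<beta>\<^sub>1"]) auto
qed

end
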